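(* Let $H\subset E$, $(\nu_t)_{t>0}$, $(P_t)_{t\ge0}$, $(U_\alpha)_{\alpha>0}$ and the Lévy process $X=(\Omega,\mathcal F,\mathcal F_t,X_t,\theta_t,P^y)$ be as in the context, and assume that (HS) and (H) hold. Let $x\in E\setminus H$ and let $q_x$, $E_x$ be as in the context. Let $v_0^x:=U_1(q_x^2)$ and, for every $z\in E$, $v_z^x:=v_0^x\circ T_z^{-1}$, where $T_z(y)=y+z$. Then, for every $z\in E$, $v_z^x$ is a compact Lyapunov function such that $E_x+z=[v_z^x<\infty]$, and each $E_x+z$ is invariant with respect to $(P_t)_{t\ge0}$, i.e. $P_t1_{E_x+z}=1_{E_x+z}$ for all $t>0$. In particular, $E_x+z$ is left invariant by the infinite dimensional Lévy process $X$, i.e. $P^y(X_t\in E_x+z\ \ \forall t\ge0)=1$ for all $y\in E_x+z$. Furthermore, the restriction of $X$ to $E_x+z$ is càdlàg in the trace topology (the topology induced on $E_x+z$ by the norm topology of $E$).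
   Context: $(H,\langle\cdot,\cdot\rangle)$ is a separable real Hilbert space with norm $|\cdot|$; $(E,\langle\cdot,\cdot\rangle_E)$ is a Hilbert space with norm $\|\cdot\|$ such that $H\subset E$ continuously and densely; identifying $H$ with $H'$, $E'\subset H\subset E$; ${}_{E'}\langle\xi,z\rangle_E=\xi(z)$. (HS): the embedding $H\subset E$ is Hilbert–Schmidt. $\psi:H\to\mathbb C$ is a continuous negative definite function (so that $e^{-t\psi}$ is positive definite for each $t>0$) with $\psi(0)=0$. For $t>0$, $\nu_t$ is the probability measure on $(E,\mathcal B(E))$ with $\int_E e^{i\,{}_{E'}\langle\xi,z\rangle_E}\nu_t(dz)=e^{-t\psi(\xi)}$, $\xi\in E'$. $P_tf(y)=\int_Ef(y+w)\nu_t(dw)$, $P_0=\mathrm{Id}$, $U_\alpha=\int_0^\infty e^{-\alpha t}P_t\,dt$. $X$ is the conservative Markov process on $E$ with càdlàg paths and transition function $(P_t)_{t\ge0}$ (it exists and is a standard process). (H): (i) there is $C>0$ such that $\int_E {}_{E'}\langle\xi,z\rangle_E^2\,\nu_t(dz)\le C(1+t^2)|\xi|^2$ for all $\xi\in E'$, $t>0$; (ii) $\nu_t(H)=0$ for all $t>0$. For $\beta>0$, a $\mathcal B(E)$-measurable $u:E\to[0,\infty]$ is $\mathcal U_\beta$-excessive if $\alpha U_{\beta+\alpha}u\le u$ for all $\alpha>0$ and $\lim_{\alpha\to\infty}\alpha U_{\beta+\alpha}u=u$ pointwise. A compact Lyapunov function is a function $v$ which is $\mathcal U_\beta$-excessive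 (here with $\beta=1$) and such that $[v\le\alpha]$ is relatively compact in $E$ for all $\alpha>0$. Fix an orthonormal basis $\{e_n:n\ge1\}$ of $H$ contained in $E'$ and $\lambda_n\in(0,\infty)$ with $\sum_n\lambda_n<\infty$ such that $\overline e_n:=e_n/\sqrt{\lambda_n}$, $n\ge1$, form an orthonormal basis of $E$ and $\lambda_n\,{}_{E'}\langle e_n,z\rangle_E=\langle e_n,z\rangle_E$ for all $n$ and $z\in E$ (such a basis exists by (HS)). Let $\alpha_n\in(0,\infty)$, $\alpha_n\nearrow\infty$, with $\sum_n\alpha_n\lambda_n<\infty$. For $x\in E\setminus H$, fix an orthonormal basis $\{e_n^x:n\ge1\}$ of $H$ with $e_n^x\in E'$, separating the points of $E$, with ${}_{E'}\langle e_n^x,x\rangle_E\ge2^{n/2}$ for all $n$ (such a basis exists), and define $$q_x(z):=\Big[\sum_{n=1}^\infty\alpha_n\lambda_n\,{}_{E'}\langle e_n,z\rangle_E^2+\Big(\sum_{n=1}^\infty2^{-n/2}|{}_{E'}\langle e_n^x,z\rangle_E|\Big)^2\Big]^{1/2},\quad z\in E,$$ $E_x:=\{z\in E:q_x(z)<\infty\}$. *)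

theory Defs
  imports "HOL-Probability.Probability"
begin

section \<open>The pair H, E and its duality\<close>

text \<open>
  \<open>H\<close> and \<open>E\<close> are types of sort \<open>{real_inner, banach, polish_space}\<close>, that is, separable real
  Hilbert spaces (\<open>E\<close> is automatically separable, because \<open>H\<close> is separable and dense in it), and
  the inclusion is an explicit map \<open>j\<close>.
\<close>

definition dense_embedding :: "('h::real_inner \<Rightarrow> 'e::real_inner) \<Rightarrow> bool" where
  "dense_embedding j \<longleftrightarrow> bounded_linear j \<and> inj j \<and> closure (range j) = UNIV"

definition orthonormal_basis :: "'a::real_inner set \<Rightarrow> bool" where
  "orthonormal_basis B \<longleftrightarrow>
     pairwise orthogonal B \<and> (\<forall>b\<in>B. norm b = 1) \<and> closure (span B) = UNIV"

definition orthonormal_basis_seq :: "(nat \<Rightarrow> 'a::real_inner) \<Rightarrow> bool" where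
  "orthonormal_basis_seq e \<longleftrightarrow> inj e \<and> orthonormal_basis (range e)"

definition hilbert_schmidt :: "('h::real_inner \<Rightarrow> 'e::real_inner) \<Rightarrow> bool" where
  "hilbert_schmidt j \<longleftrightarrow>
     bounded_linear j \<and> (\<exists>B. orthonormal_basis B \<and> (\<lambda>b. (norm (j b))\<^sup>2) summable_on B)"

text \<open>
  After identifying \<open>H\<close> with its dual, \<open>E'\<close> is the set of those \<open>\<xi> \<in> H\<close> for which
  \<open>k \<mapsto> \<langle>\<xi>, k\<rangle>\<close> is the restriction to \<open>H\<close> of a continuous linear functional on \<open>E\<close>. That
  functional is unique by density; its value at \<open>z \<in> E\<close> is the duality pairing of \<open>\<xi>\<close> and \<open>z\<close>.
\<close>

definition dual_in :: "('h::real_inner \<Rightarrow> 'e::real_inner) \<Rightarrow> 'h set" where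
  "dual_in j = {\<xi>. \<exists>f::'e \<Rightarrow>\<^sub>L real. \<forall>k. blinfun_apply f (j k) = inner \<xi> k}"

definition dual_pairing :: "('h::real_inner \<Rightarrow> 'e::real_inner) \<Rightarrow> 'h \<Rightarrow> 'e \<Rightarrow> real" where
  "dual_pairing j \<xi> z =
     blinfun_apply (THE f::'e \<Rightarrow>\<^sub>L real. \<forall>k. blinfun_apply f (j k) = inner \<xi> k) z"


section \<open>Negative definite functions, the measures and the transition function\<close>

definition negative_definite :: "('h::ab_group_add \<Rightarrow> complex) \<Rightarrow> bool" where
  "negative_definite \<psi> \<longleftrightarrow>
     (\<forall>(n::nat) (\<xi>::nat \<Rightarrow> 'h) (c::nat \<Rightarrow> complex).
        (\<Sum>k<n. \<Sum>l<n. (\<psi> (\<xi> k) + cnj (\<psi> (\<xi> l)) - \<psi> (\<xi> k - \<xi> l)) * c k * cnj (c l))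
          \<in> \<real>\<^sub>\<ge>\<^sub>0)"

definition levy_measures ::
  "('h::real_inner \<Rightarrow> 'e::real_inner) \<Rightarrow> ('h \<Rightarrow> complex) \<Rightarrow> (real \<Rightarrow> 'e measure) \<Rightarrow> bool" where
  "levy_measures j \<psi> \<nu> \<longleftrightarrow>
     (\<forall>t>0. prob_space (\<nu> t) \<and> sets (\<nu> t) = sets borel \<and>
        (\<forall>\<xi>\<in>dual_in j.
           (\<integral>z. exp (\<i> * complex_of_real (dual_pairing j \<xi> z)) \<partial>(\<nu> t))
             = exp (- complex_of_real t * \<psi> \<xi>)))"

definition hypothesis_H ::
  "('h::real_inner \<Rightarrow> 'e::real_inner) \<Rightarrow> (real \<Rightarrow> 'e measure) \<Rightarrow> bool" where
  "hypothesis_H j \<nu> \<longleftrightarrow>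
     (\<exists>C>0. \<forall>\<xi>\<in>dual_in j. \<forall>t>0.
        (\<integral>\<^sup>+z. ennreal ((dual_pairing j \<xi> z)\<^sup>2) \<partial>(\<nu> t))
          \<le> ennreal (C * (1 + t\<^sup>2) * (norm \<xi>)\<^sup>2)) \<and>
     (\<forall>t>0. range j \<in> null_sets (\<nu> t))"

definition trans_op ::
  "(real \<Rightarrow> 'e::real_normed_vector measure) \<Rightarrow> real \<Rightarrow> ('e \<Rightarrow> ennreal) \<Rightarrow> 'e \<Rightarrow> ennreal" where
  "trans_op \<nu> t f y = (if t = 0 then f y else (\<integral>\<^sup>+w. f (y + w) \<partial>(\<nu> t)))"

definition resolvent ::
  "(real \<Rightarrow> 'e::real_normed_vector measure) \<Rightarrow> real \<Rightarrow> ('e \<Rightarrow> ennreal) \<Rightarrow> 'e \<Rightarrow> ennreal" where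
  "resolvent \<nu> \<alpha> f y = (\<integral>\<^sup>+t\<in>{0..}. ennreal (exp (- \<alpha> * t)) * trans_op \<nu> t f y \<partial>lborel)"

definition excessive ::
  "(real \<Rightarrow> 'e::real_normed_vector measure) \<Rightarrow> real \<Rightarrow> ('e \<Rightarrow> ennreal) \<Rightarrow> bool" where
  "excessive \<nu> \<beta> u \<longleftrightarrow>
     u \<in> borel_measurable borel \<and>
     (\<forall>\<alpha>>0. \<forall>y. ennreal \<alpha> * resolvent \<nu> (\<beta> + \<alpha>) u y \<le> u y) \<and>
     (\<forall>y. ((\<lambda>\<alpha>. ennreal \<alpha> * resolvent \<nu> (\<beta> + \<alpha>) u y) \<longlongrightarrow> u y) at_top)"

definition compact_lyapunov ::
  "(real \<Rightarrow> 'e::real_normed_vector measure) \<Rightarrow> ('e \<Rightarrow> ennreal) \<Rightarrow> bool" where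
  "compact_lyapunov \<nu> v \<longleftrightarrow>
     excessive \<nu> 1 v \<and> (\<forall>\<alpha>::real. \<alpha> > 0 \<longrightarrow> compact (closure {y. v y \<le> ennreal \<alpha>}))"


section \<open>The process\<close>

text \<open>
  The left limits are required to exist in the space \<open>T\<close> itself; since \<open>limitin\<close> puts the limit
  into \<open>topspace T\<close>, the path also takes all its values there.
\<close>

definition cadlag_in :: "'a topology \<Rightarrow> (real \<Rightarrow> 'a) \<Rightarrow> bool" where
  "cadlag_in T x \<longleftrightarrow>
     (\<forall>t\<ge>0. limitin T x (x t) (at_right t)) \<and> (\<forall>t>0. \<exists>l. limitin T x l (at_left t))"

text \<open>
  A conservative Markov process \<open>(\<Omega>, F, F\<^sub>t, X\<^sub>t, \<theta>\<^sub>t, P\<^sup>y)\<close> on \<open>E\<close> with cadlag paths and transition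
  function \<open>(P\<^sub>t)\<close>: the measure \<open>M\<close> only supplies \<open>\<Omega>\<close> and the sigma-algebra \<open>F\<close>, times are
  \<open>t \<ge> 0\<close>, and the process is conservative because \<open>X\<^sub>t\<close> is \<open>E\<close>-valued for all times.
  Measurability of \<open>y \<mapsto> P\<^sup>y(X\<^sub>t \<in> B)\<close> is not listed: the last clause with start at time 0 says
  that this function is \<open>P\<^sub>t 1\<^sub>B\<close>.
\<close>

definition cadlag_markov_process ::
  "(real \<Rightarrow> 'e::real_normed_vector measure) \<Rightarrow> 'w measure \<Rightarrow> (real \<Rightarrow> 'w measure) \<Rightarrow>
   (real \<Rightarrow> 'w \<Rightarrow> 'e) \<Rightarrow> (real \<Rightarrow> 'w \<Rightarrow> 'w) \<Rightarrow> ('e \<Rightarrow> 'w measure) \<Rightarrow> bool" where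
  "cadlag_markov_process \<nu> M F X \<theta> P \<longleftrightarrow>
     (\<forall>t\<ge>0. subalgebra M (F t)) \<and>
     (\<forall>s\<ge>0. \<forall>t\<ge>s. sets (F s) \<subseteq> sets (F t)) \<and>
     (\<forall>t\<ge>0. X t \<in> borel_measurable (F t)) \<and>
     (\<forall>t\<ge>0. \<theta> t \<in> space M \<rightarrow> space M) \<and>
     (\<forall>s\<ge>0. \<forall>t\<ge>0. \<forall>\<omega>\<in>space M. X s (\<theta> t \<omega>) = X (s + t) \<omega>) \<and>
     (\<forall>\<omega>\<in>space M. cadlag_in euclidean (\<lambda>t. X t \<omega>)) \<and>
     (\<forall>y. prob_space (P y) \<and> sets (P y) = sets M \<and> (AE \<omega> in P y. X 0 \<omega> = y)) \<and>
     (\<forall>y. \<forall>s\<ge>0. \<forall>t\<ge>0. \<forall>B\<in>sets borel.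
        AE \<omega> in P y. nn_cond_exp (P y) (F t) (\<lambda>\<omega>'. indicator B (X (t + s) \<omega>')) \<omega>
          = trans_op \<nu> s (indicator B) (X t \<omega>))"


section \<open>The functional q, its domain and the Lyapunov functions\<close>

definition ennreal_sqrt :: "ennreal \<Rightarrow> ennreal" where
  "ennreal_sqrt a = (if a = \<infinity> then \<infinity> else ennreal (sqrt (enn2real a)))"

text \<open>
  All sequences are indexed from 0, so that \<open>e n\<close>, \<open>lam n\<close>, \<open>\<alpha> n\<close>, \<open>ex n\<close> stand for the terms with
  index \<open>n + 1\<close> of the sequences indexed by \<open>n \<ge> 1\<close>; hence the exponents \<open>(n + 1) / 2\<close> below.
\<close>

definition basis_data ::
  "('h::real_inner \<Rightarrow> 'e::real_inner) \<Rightarrow> (nat \<Rightarrow> 'h) \<Rightarrow> (nat \<Rightarrow> real) \<Rightarrow> (nat \<Rightarrow> real) \<Rightarrow> bool" where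
  "basis_data j e lam \<alpha> \<longleftrightarrow>
     orthonormal_basis_seq e \<and> range e \<subseteq> dual_in j \<and>
     (\<forall>n. lam n > 0) \<and> summable lam \<and>
     orthonormal_basis_seq (\<lambda>n. j (e n) /\<^sub>R sqrt (lam n)) \<and>
     (\<forall>n z. lam n * dual_pairing j (e n) z = inner (j (e n)) z) \<and>
     (\<forall>n. \<alpha> n > 0) \<and> incseq \<alpha> \<and> filterlim \<alpha> at_top sequentially \<and>
     summable (\<lambda>n. \<alpha> n * lam n)"

definition basis_at ::
  "('h::real_inner \<Rightarrow> 'e::real_inner) \<Rightarrow> 'e \<Rightarrow> (nat \<Rightarrow> 'h) \<Rightarrow> bool" where
  "basis_at j x ex \<longleftrightarrow>
     orthonormal_basis_seq ex \<and> range ex \<subseteq> dual_in j \<and>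
     (\<forall>z z'. z \<noteq> z' \<longrightarrow> (\<exists>n. dual_pairing j (ex n) z \<noteq> dual_pairing j (ex n) z')) \<and>
     (\<forall>n. dual_pairing j (ex n) x \<ge> 2 powr (real (n + 1) / 2))"

definition q_fun ::
  "('h::real_inner \<Rightarrow> 'e::real_inner) \<Rightarrow> (nat \<Rightarrow> 'h) \<Rightarrow> (nat \<Rightarrow> real) \<Rightarrow> (nat \<Rightarrow> real) \<Rightarrow>
   (nat \<Rightarrow> 'h) \<Rightarrow> 'e \<Rightarrow> ennreal" where
  "q_fun j e lam \<alpha> ex z =
     ennreal_sqrt
       ((\<Sum>n. ennreal (\<alpha> n * lam n * (dual_pairing j (e n) z)\<^sup>2))
        + (\<Sum>n. ennreal (2 powr (- real (n + 1) / 2) * \<bar>dual_pairing j (ex n) z\<bar>))\<^sup>2)"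

definition E_sub ::
  "('h::real_inner \<Rightarrow> 'e::real_inner) \<Rightarrow> (nat \<Rightarrow> 'h) \<Rightarrow> (nat \<Rightarrow> real) \<Rightarrow> (nat \<Rightarrow> real) \<Rightarrow>
   (nat \<Rightarrow> 'h) \<Rightarrow> 'e set" where
  "E_sub j e lam \<alpha> ex = {z. q_fun j e lam \<alpha> ex z < \<infinity>}"

definition v_fun ::
  "('h::real_inner \<Rightarrow> 'e::real_inner) \<Rightarrow> (real \<Rightarrow> 'e measure) \<Rightarrow> (nat \<Rightarrow> 'h) \<Rightarrow> (nat \<Rightarrow> real) \<Rightarrow>
   (nat \<Rightarrow> real) \<Rightarrow> (nat \<Rightarrow> 'h) \<Rightarrow> 'e \<Rightarrow> 'e \<Rightarrow> ennreal" where
  "v_fun j \<nu> e lam \<alpha> ex z =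
     resolvent \<nu> 1 (\<lambda>y. (q_fun j e lam \<alpha> ex y)\<^sup>2) \<circ> inv (\<lambda>y. y + z)"

definition E_shift ::
  "('h::real_inner \<Rightarrow> 'e::real_inner) \<Rightarrow> (nat \<Rightarrow> 'h) \<Rightarrow> (nat \<Rightarrow> real) \<Rightarrow> (nat \<Rightarrow> real) \<Rightarrow>
   (nat \<Rightarrow> 'h) \<Rightarrow> 'e \<Rightarrow> 'e set" where
  "E_shift j e lam \<alpha> ex z = (\<lambda>y. y + z) ` E_sub j e lam \<alpha> ex"

end

theory Submission
  imports Defs
begin

text \<open>
  Put \<open>Q = q\<^sub>x\<^sup>2\<close>. As \<open>q\<^sub>x\<close> is an extended seminorm, \<open>Q (y + w) \<le> 2 Q y + 2 Q w\<close>, and by (H) the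
  integral of \<open>Q\<close> against \<open>\<nu>\<^sub>t\<close> is at most a constant times \<open>1 + t\<^sup>2\<close>. Integrating the first inequality
  over \<open>w\<close> and \<open>t\<close>, once as it stands and once for \<open>y = (y + w) + (- w)\<close>, shows that \<open>U\<^sub>1 Q\<close> and \<open>Q\<close>
  bound each other up to a factor 2 and an additive constant. Hence they are finite at the same
  points, and the level sets of \<open>U\<^sub>1 Q\<close> inherit relative compactness from those of \<open>Q\<close>, which lie in
  ellipsoids whose axes shrink to 0.

  For the paths, \<open>exp (- t) U\<^sub>1 Q (X\<^sub>t)\<close> is a nonnegative supermartingale, so the maximal inequality
  bounds it almost surely over all dyadic times. Then \<open>Q\<close> is bounded along the dyadic times of every
  bounded interval, and since its level sets are closed, the path at arbitrary times and all its
  left limits stay in \<open>[Q < \<infinity>]\<close>.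
\<close>

section \<open>Paths and dyadic times\<close>

lemma cadlag_in_right_limit:
  fixes x :: "real \<Rightarrow> 'a::topological_space"
  shows "cadlag_in euclidean x \<Longrightarrow> t \<ge> 0 \<Longrightarrow> (x \<longlongrightarrow> x t) (at_right t)"
  by (auto simp: cadlag_in_def limitin_canonical_iff)

text \<open>For nonnegative \<open>t\<close>, the least multiple of \<open>1 / 2 ^ n\<close>
  strictly above \<open>t\<close>. Strictness makes the sequence converge within
  \<open>at_right t\<close>; the natural numerator fits the grid times
  \<open>real k / 2 ^ m\<close>, and for fixed \<open>n\<close> only countably many values
  occur.\<close>

definition dyadic_right :: "nat \<Rightarrow> real \<Rightarrow> real" where
  "dyadic_right n t = real (nat \<lfloor>2 ^ n * t\<rfloor> + 1) / 2 ^ n"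

lemma dyadic_right_bounds:
  assumes "t \<ge> 0"
  shows "t < dyadic_right n t" "dyadic_right n t \<le> t + 1 / 2 ^ n"
proof -
  have "real (nat \<lfloor>2 ^ n * t\<rfloor>) = of_int \<lfloor>2 ^ n * t\<rfloor>"
    using assms by simp
  moreover have "of_int \<lfloor>2 ^ n * t\<rfloor> \<le> 2 ^ n * t" "2 ^ n * t < of_int \<lfloor>2 ^ n * t\<rfloor> + 1"
    by linarith+
  ultimately show "t < dyadic_right n t" "dyadic_right n t \<le> t + 1 / 2 ^ n"
    by (auto simp: dyadic_right_def field_simps)
qed

lemma LIMSEQ_inverse_power2: "(\<lambda>n. 1 / 2 ^ n :: real) \<longlonglongrightarrow> 0"
  by (rule LIMSEQ_divide_realpow_zero) simp

lemma dyadic_right_at_right: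
  assumes "t \<ge> 0"
  shows "filterlim (\<lambda>n. dyadic_right n t) (at_right t) sequentially"
  unfolding filterlim_at
proof
  show "(\<lambda>n. dyadic_right n t) \<longlonglongrightarrow> t"
  proof (rule tendsto_sandwich[OF _ _ tendsto_const])
    show "(\<lambda>n. t + 1 / 2 ^ n) \<longlonglongrightarrow> t"
      using tendsto_add[OF tendsto_const LIMSEQ_inverse_power2, of t] by simp
  qed (use dyadic_right_bounds[OF assms] in \<open>auto intro!: always_eventually less_imp_le\<close>)
  show "\<forall>\<^sub>F n in sequentially. dyadic_right n t \<in> {t<..} \<and> dyadic_right n t \<noteq> t"
    using dyadic_right_bounds[OF assms] by (auto intro!: always_eventually less_imp_neq[symmetric] simp: not_le)
qed

text \<open>For \<open>t > 0\<close>, the greatest multiple of \<open>1 / 2 ^ n\<close> strictly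
  below \<open>t\<close>. Ceiling minus one, rather than the floor, stays strictly below
  \<open>t\<close> even when \<open>t\<close> lies on the grid. It is nonnegative, so
  \<open>nat\<close> truncates nothing.\<close>

definition dyadic_left :: "nat \<Rightarrow> real \<Rightarrow> real" where
  "dyadic_left n t = real (nat (\<lceil>2 ^ n * t\<rceil> - 1)) / 2 ^ n"

lemma dyadic_left_bounds:
  assumes "t > 0"
  shows "dyadic_left n t < t" "t - 1 / 2 ^ n \<le> dyadic_left n t"
proof -
  have "0 < 2 ^ n * t" using assms by simp
  then have "0 < \<lceil>2 ^ n * t\<rceil>" by linarith
  then have "real (nat (\<lceil>2 ^ n * t\<rceil> - 1)) = of_int \<lceil>2 ^ n * t\<rceil> - 1"
    by simp
  moreover have "of_int \<lceil>2 ^ n * t\<rceil> < 2 ^ n * t + 1" "2 ^ n * t \<le> of_int \<lceil>2 ^ n * t\<rceil>"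
    by linarith+
  ultimately show "dyadic_left n t < t" "t - 1 / 2 ^ n \<le> dyadic_left n t"
    by (auto simp: dyadic_left_def field_simps)
qed

lemma dyadic_left_at_left:
  assumes "t > 0"
  shows "filterlim (\<lambda>n. dyadic_left n t) (at_left t) sequentially"
  unfolding filterlim_at
proof
  show "(\<lambda>n. dyadic_left n t) \<longlonglongrightarrow> t"
  proof (rule tendsto_sandwich[OF _ _ _ tendsto_const])
    show "(\<lambda>n. t - 1 / 2 ^ n) \<longlonglongrightarrow> t"
      using tendsto_diff[OF tendsto_const LIMSEQ_inverse_power2, of t] by simp
  qed (use dyadic_left_bounds[OF assms] in \<open>auto intro!: always_eventually less_imp_le\<close>)
  show "\<forall>\<^sub>F n in sequentially. dyadic_left n t \<in> {..<t} \<and> dyadic_left n t \<noteq> t"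
    using dyadic_left_bounds[OF assms] by (auto intro!: always_eventually less_imp_neq)
qed

text \<open>A value is the limit of values at dyadic times from the right, a left limit that of
  values at dyadic times from the left, so both lie in the closed set \<open>K\<close> of the dyadic
  values up to \<open>N\<close>. \<open>K\<close> is closed in the whole space, while
  \<open>S\<close> need not be.\<close>

lemma cadlag_in_top_of_set:
  fixes x :: "real \<Rightarrow> 'a::topological_space"
  assumes cadlag: "cadlag_in euclidean x"
    and dyadic: "\<And>N::nat. \<exists>K. closed K \<and> K \<subseteq> S \<and> (\<forall>m k. real k / 2 ^ m \<le> real N \<longrightarrow> x (real k / 2 ^ m) \<in> K)"
  shows "cadlag_in (top_of_set S) x" and "\<forall>t\<ge>0. x t \<in> S"
proof -
  show S: "\<forall>t\<ge>0. x t \<in> S"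
  proof (intro allI impI)
    fix t :: real assume t: "t \<ge> 0"
    \<comment> \<open>The extra 1 leaves room for \<open>dyadic_right n t\<close>, which may exceed
      \<open>t\<close> by up to 1.\<close>
    obtain N :: nat where N: "t + 1 \<le> real N" using real_arch_simple by blast
    obtain K where K: "closed K" "K \<subseteq> S" "\<And>m k. real k / 2 ^ m \<le> real N \<Longrightarrow> x (real k / 2 ^ m) \<in> K"
      using dyadic[of N] by blast
    have "x (dyadic_right n t) \<in> K" for n
    proof -
      have "1 / 2 ^ n \<le> (1::real)" by simp
      then have "dyadic_right n t \<le> real N" using dyadic_right_bounds(2)[OF t, of n] N by linarith
      then show ?thesis unfolding dyadic_right_def by (rule K(3))
    qed
    moreover have "(\<lambda>n. x (dyadic_right n t)) \<longlonglongrightarrow> x t"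
      using filterlim_compose[OF cadlag_in_right_limit[OF cadlag t] dyadic_right_at_right[OF t]] .
    ultimately have "x t \<in> K" using K(1) by (meson closed_sequentially)
    then show "x t \<in> S" using K(2) by blast
  qed
  show "cadlag_in (top_of_set S) x"
    unfolding cadlag_in_def
  proof (intro conjI allI impI)
    fix t :: real assume t: "t \<ge> 0"
    have "\<forall>\<^sub>F u in at_right t. x u \<in> S"
      using S t by (auto simp: eventually_at_right_field intro!: exI[of _ "t + 1"])
    then show "limitin (top_of_set S) x (x t) (at_right t)"
      using cadlag_in_right_limit[OF cadlag t] S t by (simp add: limitin_subtopology limitin_canonical_iff)
  next
    fix t :: real assume t: "t > 0"
    then obtain l where l: "(x \<longlongrightarrow> l) (at_left t)"
      using cadlag by (auto simp: cadlag_in_def limitin_canonical_iff)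
    obtain N :: nat where N: "t \<le> real N" using real_arch_simple by blast
    obtain K where K: "closed K" "K \<subseteq> S" "\<And>m k. real k / 2 ^ m \<le> real N \<Longrightarrow> x (real k / 2 ^ m) \<in> K"
      using dyadic[of N] by blast
    have "x (dyadic_left n t) \<in> K" for n
    proof -
      have "dyadic_left n t \<le> real N" using dyadic_left_bounds(1)[OF t, of n] N by linarith
      then show ?thesis unfolding dyadic_left_def by (rule K(3))
    qed
    moreover have "(\<lambda>n. x (dyadic_left n t)) \<longlonglongrightarrow> l"
      using filterlim_compose[OF l dyadic_left_at_left[OF t]] .
    ultimately have "l \<in> S" using K by (meson closed_sequentially subsetD)
    moreover have "\<forall>\<^sub>F u in at_left t. x u \<in> S"
      using S t by (auto simp: eventually_at_left_field intro!: exI[of _ 0])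
    ultimately show "\<exists>l. limitin (top_of_set S) x l (at_left t)"
      using l by (auto simp: limitin_subtopology limitin_canonical_iff)
  qed
qed

section \<open>Cadlag processes with independent increments\<close>

text \<open>Doob's argument. By induction on \<open>k\<close>, \<open>c\<close> times the measure of
  the event that level \<open>c\<close> has been reached by step \<open>k\<close>, plus the integral
  of \<open>Z k\<close> over the remaining event, is at most the integral of \<open>Z 0\<close>. The
  supermartingale inequality is used exactly on these remaining events, so it is required there and
  no filtration appears.\<close>

lemma maximal_inequality:
  fixes Z :: "nat \<Rightarrow> 'a \<Rightarrow> ennreal" and c :: ennreal
  assumes [measurable]: "\<And>k. Z k \<in> borel_measurable M"
    and super: "\<And>k. (\<integral>\<^sup>+\<omega>. indicator {\<omega>\<in>space M. \<forall>i\<le>k. Z i \<omega> < c} \<omega> * Z (Suc k) \<omega> \<partial>M)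
        \<le> (\<integral>\<^sup>+\<omega>. indicator {\<omega>\<in>space M. \<forall>i\<le>k. Z i \<omega> < c} \<omega> * Z k \<omega> \<partial>M)"
  shows "c * emeasure M {\<omega>\<in>space M. \<exists>k. c \<le> Z k \<omega>} \<le> (\<integral>\<^sup>+\<omega>. Z 0 \<omega> \<partial>M)"
proof -
  define A where "A k = {\<omega>\<in>space M. \<forall>i\<le>k. Z i \<omega> < c}" for k
  define B where "B k = {\<omega>\<in>space M. \<exists>i\<le>k. c \<le> Z i \<omega>}" for k
  have [measurable]: "A k \<in> sets M" "B k \<in> sets M" for k
    unfolding A_def B_def by measurable
  have step: "c * emeasure M (B k) + (\<integral>\<^sup>+\<omega>. indicator (A k) \<omega> * Z k \<omega> \<partial>M) \<le> (\<integral>\<^sup>+\<omega>. Z 0 \<omega> \<partial>M)" for k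
  proof (induction k)
    case 0
    have "c * emeasure M (B 0) + (\<integral>\<^sup>+\<omega>. indicator (A 0) \<omega> * Z 0 \<omega> \<partial>M)
        = (\<integral>\<^sup>+\<omega>. c * indicator (B 0) \<omega> + indicator (A 0) \<omega> * Z 0 \<omega> \<partial>M)"
      by (subst nn_integral_add) (auto simp: nn_integral_cmult_indicator)
    also have "\<dots> \<le> (\<integral>\<^sup>+\<omega>. Z 0 \<omega> \<partial>M)"
      by (rule nn_integral_mono) (auto simp: A_def B_def split: split_indicator)
    finally show ?case .
  next
    case (Suc k)
    \<comment> \<open>\<open>D\<close> is the event that level \<open>c\<close> is reached for the
      first time at step \<open>Suc k\<close>; on it \<open>Z (Suc k)\<close> dominates the newly
      added \<open>c\<close>.\<close>
    define D where "D = {\<omega>\<in>space M. \<omega> \<in> A k \<and> c \<le> Z (Suc k) \<omega>}"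
    have [measurable]: "D \<in> sets M" unfolding D_def by measurable
    have BD: "B (Suc k) = B k \<union> D" "B k \<inter> D = {}"
      by (force simp: B_def D_def A_def le_Suc_eq not_le[symmetric])+
    have "c * emeasure M (B (Suc k)) + (\<integral>\<^sup>+\<omega>. indicator (A (Suc k)) \<omega> * Z (Suc k) \<omega> \<partial>M)
       = c * emeasure M (B k) + (\<integral>\<^sup>+\<omega>. c * indicator D \<omega> + indicator (A (Suc k)) \<omega> * Z (Suc k) \<omega> \<partial>M)"
      unfolding BD(1) using BD(2)
      by (subst nn_integral_add)
         (auto simp: nn_integral_cmult_indicator plus_emeasure[symmetric] distrib_left add.assoc)
    also have "(\<integral>\<^sup>+\<omega>. c * indicator D \<omega> + indicator (A (Suc k)) \<omega> * Z (Suc k) \<omega> \<partial>M)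
        \<le> (\<integral>\<^sup>+\<omega>. indicator (A k) \<omega> * Z (Suc k) \<omega> \<partial>M)"
      by (rule nn_integral_mono) (auto simp: A_def D_def le_Suc_eq split: split_indicator)
    also have "\<dots> \<le> (\<integral>\<^sup>+\<omega>. indicator (A k) \<omega> * Z k \<omega> \<partial>M)"
      using super[of k] by (simp add: A_def)
    also have "c * emeasure M (B k) + \<dots> \<le> (\<integral>\<^sup>+\<omega>. Z 0 \<omega> \<partial>M)" by (rule Suc.IH)
    finally show ?case by (simp add: add_left_mono)
  qed
  have "{\<omega>\<in>space M. \<exists>k. c \<le> Z k \<omega>} = (\<Union>k. B k)" by (auto simp: B_def)
  also have "emeasure M (\<Union>k. B k) = (SUP k. emeasure M (B k))"
    by (rule SUP_emeasure_incseq[symmetric]) (auto simp: B_def incseq_def intro: order_trans)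
  also have "c * (SUP k. emeasure M (B k)) = (SUP k. c * emeasure M (B k))"
    by (rule SUP_mult_left_ennreal)
  also have "\<dots> \<le> (\<integral>\<^sup>+\<omega>. Z 0 \<omega> \<partial>M)"
  proof (rule SUP_least)
    show "c * emeasure M (B k) \<le> (\<integral>\<^sup>+\<omega>. Z 0 \<omega> \<partial>M)" for k
      by (rule order_trans[OF _ step[of k]]) simp
  qed
  finally show ?thesis .
qed

lemma ennreal_exp_mult: "ennreal (exp a) * (ennreal (exp b) * x) = ennreal (exp (a + b)) * x"
  by (simp add: exp_add ennreal_mult mult.assoc)

section \<open>The Markov property and the transition semigroup\<close>

locale cadlag_levy =
  fixes \<nu> :: "real \<Rightarrow> 'e::{real_normed_vector, polish_space} measure"
    and M :: "'w measure" and F :: "real \<Rightarrow> 'w measure"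
    and X :: "real \<Rightarrow> 'w \<Rightarrow> 'e" and \<theta> :: "real \<Rightarrow> 'w \<Rightarrow> 'w" and P :: "'e \<Rightarrow> 'w measure"
  assumes process: "cadlag_markov_process \<nu> M F X \<theta> P"
    and prob_nu: "\<And>t. t > 0 \<Longrightarrow> prob_space (\<nu> t)"
    and sets_nu: "\<And>t. t > 0 \<Longrightarrow> sets (\<nu> t) = sets borel"
begin

lemma prob_P: "prob_space (P y)"
  and sets_P [measurable_cong]: "sets (P y) = sets M"
  and X_0: "AE \<omega> in P y. X 0 \<omega> = y"
  using process by (auto simp: cadlag_markov_process_def)

lemma space_P: "space (P y) = space M"
  using sets_P by (rule sets_eq_imp_space_eq)

lemma subalgebra_M: "t \<ge> 0 \<Longrightarrow> subalgebra M (F t)"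
  and F_mono: "0 \<le> s \<Longrightarrow> s \<le> t \<Longrightarrow> sets (F s) \<subseteq> sets (F t)"
  and X_adapted: "t \<ge> 0 \<Longrightarrow> X t \<in> borel_measurable (F t)"
  using process by (auto simp: cadlag_markov_process_def)

lemma subalgebra_P: "t \<ge> 0 \<Longrightarrow> subalgebra (P y) (F t)"
  using subalgebra_M by (simp add: subalgebra_def space_P sets_P)

lemma space_F: "t \<ge> 0 \<Longrightarrow> space (F t) = space M"
  using subalgebra_M by (simp add: subalgebra_def)

lemma subalgebra_F: "0 \<le> s \<Longrightarrow> s \<le> t \<Longrightarrow> subalgebra (F t) (F s)"
  using F_mono by (simp add: subalgebra_def space_F)

lemma X_measurable: "t \<ge> 0 \<Longrightarrow> X t \<in> borel_measurable M"
  by (rule measurable_from_subalg[OF subalgebra_M X_adapted])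

lemma X_measurable_F: "0 \<le> s \<Longrightarrow> s \<le> t \<Longrightarrow> X s \<in> borel_measurable (F t)"
  by (rule measurable_from_subalg[OF subalgebra_F X_adapted])

lemma cadlag_X: "\<omega> \<in> space M \<Longrightarrow> cadlag_in euclidean (\<lambda>t. X t \<omega>)"
  using process by (auto simp: cadlag_markov_process_def)

lemma trans_op_measurable:
  assumes [measurable]: "f \<in> borel_measurable borel" and "t \<ge> 0"
  shows "trans_op \<nu> t f \<in> borel_measurable borel"
proof (cases "t = 0")
  case False
  with assms have t: "t > 0" by simp
  interpret prob_space "\<nu> t" using prob_nu t .
  have [measurable_cong]: "sets (\<nu> t) = sets borel" using sets_nu t .
  show ?thesis unfolding trans_op_def[abs_def] using False by simp
qed (simp add: trans_op_def[abs_def])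

lemma trans_op_cmult:
  assumes [measurable]: "f \<in> borel_measurable borel" and "t \<ge> 0"
  shows "trans_op \<nu> t (\<lambda>y. c * f y) y = c * trans_op \<nu> t f y"
proof (cases "t = 0")
  case False
  with assms have t: "t > 0" by simp
  have [measurable_cong]: "sets (\<nu> t) = sets borel" using sets_nu t .
  show ?thesis unfolding trans_op_def using False by (simp add: nn_integral_cmult)
qed (simp add: trans_op_def)

lemma trans_op_add:
  assumes [measurable]: "f \<in> borel_measurable borel" "g \<in> borel_measurable borel" and "t \<ge> 0"
  shows "trans_op \<nu> t (\<lambda>y. f y + g y) y = trans_op \<nu> t f y + trans_op \<nu> t g y"
proof (cases "t = 0")
  case False
  with assms have t: "t > 0" by simp
  have [measurable_cong]: "sets (\<nu> t) = sets borel" using sets_nu t .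
  show ?thesis unfolding trans_op_def using False by (simp add: nn_integral_add)
qed (simp add: trans_op_def)

lemma trans_op_SUP:
  assumes [measurable]: "\<And>i. U i \<in> borel_measurable borel" and "incseq U" and "t \<ge> 0"
  shows "trans_op \<nu> t (\<lambda>w. SUP i. U i w) y = (SUP i. trans_op \<nu> t (U i) y)"
proof (cases "t = 0")
  case False
  with assms have t: "t > 0" by simp
  have [measurable_cong]: "sets (\<nu> t) = sets borel" using sets_nu t .
  have "incseq (\<lambda>i w. U i (y + w))"
    using \<open>incseq U\<close> by (auto simp: incseq_def le_fun_def)
  then show ?thesis unfolding trans_op_def using False
    by (simp add: nn_integral_monotone_convergence_SUP image_comp)
qed (simp add: trans_op_def image_comp)

text \<open>The definition of the process gives this for indicators of Borel sets. Both sides are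
  additive, homogeneous and continuous along increasing sequences in \<open>f\<close>, so it extends
  to all nonnegative Borel functions.\<close>

lemma markov_property:
  assumes f: "f \<in> borel_measurable borel" and s: "s \<ge> 0" and t: "t \<ge> 0" and A: "A \<in> sets (F t)"
  shows "(\<integral>\<^sup>+\<omega>. indicator A \<omega> * f (X (t + s) \<omega>) \<partial>P y)
    = (\<integral>\<^sup>+\<omega>. indicator A \<omega> * trans_op \<nu> s f (X t \<omega>) \<partial>P y)"
proof -
  have [measurable]: "X t \<in> borel_measurable M" "X (t + s) \<in> borel_measurable M"
    using s t by (auto intro: X_measurable)
  have [measurable]: "A \<in> sets M" using A subalgebra_M[OF t] by (auto simp: subalgebra_def)
  have [measurable]: "trans_op \<nu> s g \<in> borel_measurable borel" if "g \<in> borel_measurable borel" for g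
    using trans_op_measurable[OF that s] .
  show ?thesis
    using f
  proof (induction rule: borel_measurable_induct)
    case (cong f g) then show ?case by (auto simp: fun_eq_iff)
  next
    case (set B)
    note [measurable] = set
    interpret finite_measure_subalgebra "P y" "F t"
      using prob_P[of y] subalgebra_P[OF t]
      by (simp add: finite_measure_subalgebra_def finite_measure_subalgebra_axioms_def prob_space_def)
    have "(\<integral>\<^sup>+\<omega>. indicator A \<omega> * indicator B (X (t + s) \<omega>) \<partial>P y)
      = (\<integral>\<^sup>+\<omega>. indicator A \<omega> * nn_cond_exp (P y) (F t) (\<lambda>\<omega>. indicator B (X (t + s) \<omega>)) \<omega> \<partial>P y)"
      using A by (intro nn_cond_exp_intg[symmetric]) auto
    also have "\<dots> = (\<integral>\<^sup>+\<omega>. indicator A \<omega> * trans_op \<nu> s (indicator B) (X t \<omega>) \<partial>P y)"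
    proof (rule nn_integral_cong_AE)
      have "AE \<omega> in P y. nn_cond_exp (P y) (F t) (\<lambda>\<omega>'. indicator B (X (t + s) \<omega>')) \<omega>
          = trans_op \<nu> s (indicator B) (X t \<omega>)"
        using process s t set by (auto simp: cadlag_markov_process_def)
      then show "AE \<omega> in P y. indicator A \<omega> * nn_cond_exp (P y) (F t) (\<lambda>\<omega>'. indicator B (X (t + s) \<omega>')) \<omega>
          = indicator A \<omega> * trans_op \<nu> s (indicator B) (X t \<omega>)" by auto
    qed
    finally show ?case .
  next
    case (mult u c)
    note [measurable] = mult(1)
    show ?case using mult by (simp add: trans_op_cmult s mult.left_commute nn_integral_cmult)
  next
    case (add u v)
    note [measurable] = add(1,3)
    show ?case using add by (simp add: trans_op_add s distrib_left nn_integral_add)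
  next
    case (seq U)
    note [measurable] = seq(1)
    have 1: "incseq (\<lambda>i \<omega>. indicator A \<omega> * U i (X (t + s) \<omega>))"
      using seq by (auto simp: incseq_def le_fun_def intro!: mult_left_mono)
    have 2: "incseq (\<lambda>i \<omega>. indicator A \<omega> * trans_op \<nu> s (U i) (X t \<omega>))"
      using seq by (auto simp: incseq_def le_fun_def trans_op_def intro!: mult_left_mono nn_integral_mono)
    show ?case
      using seq
      by (simp add: trans_op_SUP s SUP_mult_left_ennreal nn_integral_monotone_convergence_SUP[OF 1]
          nn_integral_monotone_convergence_SUP[OF 2] image_comp)
  qed
qed

text \<open>This is the Markov property at time 0 over the whole space, where \<open>X 0\<close>
  equals \<open>y\<close> almost surely.\<close>

lemma law_X:
  assumes f[measurable]: "f \<in> borel_measurable borel" and t: "t \<ge> 0"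
  shows "(\<integral>\<^sup>+\<omega>. f (X t \<omega>) \<partial>P y) = trans_op \<nu> t f y"
proof -
  interpret prob_space "P y" by (rule prob_P)
  have "(\<integral>\<^sup>+\<omega>. f (X t \<omega>) \<partial>P y) = (\<integral>\<^sup>+\<omega>. indicator (space M) \<omega> * f (X (0 + t) \<omega>) \<partial>P y)"
    by (rule nn_integral_cong) (simp add: space_P)
  also have "\<dots> = (\<integral>\<^sup>+\<omega>. indicator (space M) \<omega> * trans_op \<nu> t f (X 0 \<omega>) \<partial>P y)"
    by (rule markov_property) (auto simp: t space_F[symmetric, of 0])
  also have "\<dots> = (\<integral>\<^sup>+\<omega>. trans_op \<nu> t f y \<partial>P y)"
    by (rule nn_integral_cong_AE) (use X_0[of y] AE_space[of "P y"] in \<open>eventually_elim, simp add: space_P\<close>)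
  finally show ?thesis by (simp add: emeasure_space_1)
qed

text \<open>
  Nothing is assumed about how \<open>\<nu> t\<close> depends on \<open>t\<close>. Measurability of \<open>P\<^sub>t f y\<close> in \<open>t\<close> comes from
  writing it as an expectation over the process started at 0, whose paths are right-continuous;
  \<open>max 0 t\<close> discards the meaningless negative times.
\<close>

lemma trans_op_eq_expectation:
  assumes f[measurable]: "f \<in> borel_measurable borel" and t: "t \<ge> 0"
  shows "trans_op \<nu> t f y = (\<integral>\<^sup>+\<omega>. f (y + X t \<omega>) \<partial>P 0)"
  using law_X[of "\<lambda>w. f (y + w)" t 0] t by (auto simp: trans_op_def)

text \<open>Both sides are the expectation of \<open>f (X (s + t))\<close> under \<open>P y\<close>,
  one of them computed by conditioning at time \<open>s\<close>. The semigroup law thus comes from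
  the process rather than from convolving the measures \<open>\<nu> t\<close>.\<close>

lemma chapman_kolmogorov:
  assumes f[measurable]: "f \<in> borel_measurable borel" and s: "s \<ge> 0" and t: "t \<ge> 0"
  shows "trans_op \<nu> s (trans_op \<nu> t f) y = trans_op \<nu> (s + t) f y"
proof -
  have "trans_op \<nu> (s + t) f y = (\<integral>\<^sup>+\<omega>. indicator (space M) \<omega> * f (X (s + t) \<omega>) \<partial>P y)"
    using s t by (subst law_X[symmetric]) (auto simp: space_P intro!: nn_integral_cong)
  also have "\<dots> = (\<integral>\<^sup>+\<omega>. indicator (space M) \<omega> * trans_op \<nu> t f (X s \<omega>) \<partial>P y)"
    by (rule markov_property) (auto simp: s t space_F[symmetric, of s])
  also have "\<dots> = (\<integral>\<^sup>+\<omega>. trans_op \<nu> t f (X s \<omega>) \<partial>P y)"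
    by (auto simp: space_P intro!: nn_integral_cong)
  also have "\<dots> = trans_op \<nu> s (trans_op \<nu> t f) y"
    using s t by (intro law_X trans_op_measurable) auto
  finally show ?thesis ..
qed

text \<open>For fixed \<open>n\<close> the times \<open>dyadic_right n\<close> form a countable set,
  so the process sampled there is jointly measurable; right-continuity makes the process the
  pointwise limit in \<open>n\<close>.\<close>

lemma X_joint_measurable:
  "(\<lambda>(t, \<omega>). X (max 0 t) \<omega>) \<in> borel_measurable (borel \<Otimes>\<^sub>M M)"
proof (rule borel_measurable_LIMSEQ_metric)
  fix n
  have [measurable]: "X (real k / 2 ^ n) \<in> borel_measurable M" for k
    by (rule X_measurable) simp
  have "(\<lambda>p. X (real (nat \<lfloor>2 ^ n * max 0 (fst p) :: real\<rfloor> + 1) / 2 ^ n) (snd p)) \<in> borel_measurable (borel \<Otimes>\<^sub>M M)"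
    by (rule measurable_compose_countable[where f = "\<lambda>k p. X (real k / 2 ^ n) (snd p)"]) measurable
  then show "(\<lambda>p. X (dyadic_right n (max 0 (fst p))) (snd p)) \<in> borel_measurable (borel \<Otimes>\<^sub>M M)"
    by (simp add: dyadic_right_def)
next
  fix p :: "real \<times> 'w" assume "p \<in> space (borel \<Otimes>\<^sub>M M)"
  then have "snd p \<in> space M" by (auto simp: space_pair_measure)
  then have "((\<lambda>t. X t (snd p)) \<longlongrightarrow> X (max 0 (fst p)) (snd p)) (at_right (max 0 (fst p)))"
    by (intro cadlag_in_right_limit cadlag_X) auto
  from filterlim_compose[OF this dyadic_right_at_right]
  show "(\<lambda>n. X (dyadic_right n (max 0 (fst p))) (snd p)) \<longlonglongrightarrow> (case p of (t, \<omega>) \<Rightarrow> X (max 0 t) \<omega>)"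
    by (simp add: case_prod_beta)
qed

text \<open>Under \<open>P 0\<close> the starting point \<open>y\<close> enters only as a
  translation, so the expectation integrates out one variable of a jointly measurable
  function.\<close>

lemma trans_op_joint_measurable:
  assumes [measurable]: "f \<in> borel_measurable borel"
  shows "(\<lambda>(t, y). trans_op \<nu> (max 0 t) f y) \<in> borel_measurable (borel \<Otimes>\<^sub>M borel)"
proof -
  interpret prob_space "P 0" by (rule prob_P)
  note [measurable] = X_joint_measurable
  have *: "(\<lambda>q. (case (fst (fst q), snd q) of (t, \<omega>) \<Rightarrow> X (max 0 t) \<omega>)) \<in> borel_measurable ((borel \<Otimes>\<^sub>M borel) \<Otimes>\<^sub>M P 0)"
    by measurable
  have [measurable]: "(\<lambda>q. X (max 0 (fst (fst q))) (snd q)) \<in> borel_measurable ((borel \<Otimes>\<^sub>M borel) \<Otimes>\<^sub>M P 0)"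
    using * by simp
  show ?thesis
    by (subst trans_op_eq_expectation) (auto simp: case_prod_beta)
qed

lemma trans_op_time_measurable:
  assumes "f \<in> borel_measurable borel"
  shows "(\<lambda>t. trans_op \<nu> (max 0 t) f y) \<in> borel_measurable borel"
  using measurable_compose[OF _ trans_op_joint_measurable[OF assms], of "\<lambda>t. (t, y)" borel] by simp

section \<open>Resolvents as supermedian and excessive functions\<close>

lemma resolvent_eq:
  "resolvent \<nu> \<beta> f y
    = (\<integral>\<^sup>+t. ennreal (exp (- \<beta> * t)) * trans_op \<nu> (max 0 t) f y * indicator {0..} t \<partial>lborel)"
  unfolding resolvent_def by (rule nn_integral_cong) (auto split: split_indicator)

lemma resolvent_measurable [measurable]:
  assumes "f \<in> borel_measurable borel"
  shows "resolvent \<nu> \<beta> f \<in> borel_measurable borel"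
proof -
  have "(\<lambda>(y, t). (t, y)) \<in> borel \<Otimes>\<^sub>M lborel \<rightarrow>\<^sub>M borel \<Otimes>\<^sub>M (borel :: 'e measure)"
    by measurable
  from measurable_compose[OF this trans_op_joint_measurable[OF assms]]
  have [measurable]: "(\<lambda>p. trans_op \<nu> (max 0 (snd p)) f (fst p)) \<in> borel_measurable (borel \<Otimes>\<^sub>M lborel)"
    by (simp add: case_prod_beta)
  show ?thesis unfolding resolvent_eq[abs_def]
    by (rule lborel.borel_measurable_nn_integral) (simp add: case_prod_beta)
qed

text \<open>Tonelli moves the transition operator inside the time integral, the semigroup law adds
  the two times, and the substitution \<open>r = s + t\<close> leaves the part of the resolvent
  integral from \<open>s\<close> on.\<close>

lemma trans_op_resolvent:
  assumes f[measurable]: "f \<in> borel_measurable borel" and s: "s \<ge> 0"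
  shows "ennreal (exp (- \<beta> * s)) * trans_op \<nu> s (resolvent \<nu> \<beta> f) y
    = (\<integral>\<^sup>+r\<in>{s..}. ennreal (exp (- \<beta> * r)) * trans_op \<nu> r f y \<partial>lborel)"
proof -
  interpret P0: prob_space "P 0" by (rule prob_P)
  interpret pair_sigma_finite lborel "P 0" ..
  have [measurable]: "X s \<in> borel_measurable M" using X_measurable s .
  have [measurable]: "(\<lambda>t. trans_op \<nu> (max 0 t) f y) \<in> borel_measurable borel"
    by (rule trans_op_time_measurable) fact
  have "(\<lambda>(t, \<omega>). (t, y + X s \<omega>)) \<in> lborel \<Otimes>\<^sub>M P 0 \<rightarrow>\<^sub>M borel \<Otimes>\<^sub>M borel"
    by measurable
  from measurable_compose[OF this trans_op_joint_measurable[OF f]]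
  have [measurable]: "(\<lambda>p. trans_op \<nu> (max 0 (fst p)) f (y + X s (snd p))) \<in> borel_measurable (lborel \<Otimes>\<^sub>M P 0)"
    by (simp add: case_prod_beta)
  have [measurable]: "(\<lambda>\<omega>. trans_op \<nu> (max 0 t) f (y + X s \<omega>)) \<in> borel_measurable (P 0)" for t
    by (rule measurable_compose[OF _ trans_op_measurable]) auto
  define h where "h r = ennreal (exp (- \<beta> * r)) * trans_op \<nu> (max 0 r) f y * indicator {s..} r" for r
  have [measurable]: "h \<in> borel_measurable borel" unfolding h_def by measurable
  have "trans_op \<nu> s (resolvent \<nu> \<beta> f) y = (\<integral>\<^sup>+\<omega>. resolvent \<nu> \<beta> f (y + X s \<omega>) \<partial>P 0)"
    using s by (intro trans_op_eq_expectation) auto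
  also have "\<dots> = (\<integral>\<^sup>+t. (\<integral>\<^sup>+\<omega>. ennreal (exp (- \<beta> * t)) * trans_op \<nu> (max 0 t) f (y + X s \<omega>) * indicator {0..} t \<partial>P 0) \<partial>lborel)"
    unfolding resolvent_eq by (rule Fubini') (simp add: case_prod_beta)
  also have "\<dots> = (\<integral>\<^sup>+t. ennreal (exp (- \<beta> * t)) * indicator {0..} t * trans_op \<nu> (s + max 0 t) f y \<partial>lborel)"
  proof (rule nn_integral_cong)
    fix t :: real
    have "(\<integral>\<^sup>+\<omega>. ennreal (exp (- \<beta> * t)) * trans_op \<nu> (max 0 t) f (y + X s \<omega>) * indicator {0..} t \<partial>P 0)
      = ennreal (exp (- \<beta> * t)) * indicator {0..} t * (\<integral>\<^sup>+\<omega>. trans_op \<nu> (max 0 t) f (y + X s \<omega>) \<partial>P 0)"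
      by (subst nn_integral_cmult[symmetric]) (auto simp: mult_ac)
    also have "(\<integral>\<^sup>+\<omega>. trans_op \<nu> (max 0 t) f (y + X s \<omega>) \<partial>P 0) = trans_op \<nu> s (trans_op \<nu> (max 0 t) f) y"
      using s by (intro trans_op_eq_expectation[symmetric] trans_op_measurable) auto
    also have "\<dots> = trans_op \<nu> (s + max 0 t) f y"
      using s by (intro chapman_kolmogorov) auto
    finally show "(\<integral>\<^sup>+\<omega>. ennreal (exp (- \<beta> * t)) * trans_op \<nu> (max 0 t) f (y + X s \<omega>) * indicator {0..} t \<partial>P 0)
      = ennreal (exp (- \<beta> * t)) * indicator {0..} t * trans_op \<nu> (s + max 0 t) f y" .
  qed
  finally have 1: "trans_op \<nu> s (resolvent \<nu> \<beta> f) y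
    = (\<integral>\<^sup>+t. ennreal (exp (- \<beta> * t)) * indicator {0..} t * trans_op \<nu> (s + max 0 t) f y \<partial>lborel)" .
  have 2: "ennreal (exp (- \<beta> * s)) * (ennreal (exp (- \<beta> * t)) * indicator {0..} t * trans_op \<nu> (s + max 0 t) f y) = h (s + t)" for t
    using s by (auto simp: h_def ennreal_exp_mult algebra_simps split: split_indicator)
  \<comment> \<open>Measurability in \<open>t\<close> is read off from \<open>h\<close>, already
    known to be measurable: undoing the factor \<open>exp (- \<beta> * s)\<close> expresses the
    integrand through \<open>h (s + t)\<close>.\<close>
  have "(\<lambda>t. ennreal (exp (- \<beta> * t)) * indicator {0..} t * trans_op \<nu> (s + max 0 t) f y)
      = (\<lambda>t. ennreal (exp (\<beta> * s)) * h (s + t))"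
    by (simp add: 2[symmetric] fun_eq_iff ennreal_exp_mult del: mult_minus_left)
  then have "(\<lambda>t. ennreal (exp (- \<beta> * t)) * indicator {0..} t * trans_op \<nu> (s + max 0 t) f y) \<in> borel_measurable lborel"
    by simp
  then have "ennreal (exp (- \<beta> * s)) * trans_op \<nu> s (resolvent \<nu> \<beta> f) y = (\<integral>\<^sup>+t. h (s + 1 * t) \<partial>lborel)"
    unfolding 1 by (subst nn_integral_cmult[symmetric]) (simp_all only: 2 mult_1)
  also have "\<dots> = (\<integral>\<^sup>+r. h r \<partial>lborel)"
    by (subst nn_integral_real_affine[of h 1 s]) auto
  also have "\<dots> = (\<integral>\<^sup>+r\<in>{s..}. ennreal (exp (- \<beta> * r)) * trans_op \<nu> r f y \<partial>lborel)"
    using s by (intro nn_integral_cong) (auto simp: h_def max_def split: split_indicator)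
  finally show ?thesis .
qed

text \<open>The left side is a tail of the integral on the right.\<close>

lemma resolvent_supermedian:
  assumes "f \<in> borel_measurable borel" and "s \<ge> 0"
  shows "ennreal (exp (- \<beta> * s)) * trans_op \<nu> s (resolvent \<nu> \<beta> f) y \<le> resolvent \<nu> \<beta> f y"
  unfolding trans_op_resolvent[OF assms] resolvent_def
  using assms(2) by (intro nn_integral_mono) (auto split: split_indicator)

text \<open>The resolvent equation, with the difference of the resolvents at \<open>\<beta>\<close>
  and \<open>\<beta> + \<alpha>\<close> put under the integral as the weight
  \<open>1 - exp (- \<alpha> * r)\<close>, so that possibly infinite values are never subtracted. It
  comes from integrating over the pairs \<open>s \<le> r\<close> in the other order.\<close>

lemma resolvent_resolvent:
  assumes f[measurable]: "f \<in> borel_measurable borel" and \<alpha>: "\<alpha> > 0"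
  shows "ennreal \<alpha> * resolvent \<nu> (\<beta> + \<alpha>) (resolvent \<nu> \<beta> f) y
    = (\<integral>\<^sup>+r\<in>{0..}. ennreal (exp (- \<beta> * r)) * trans_op \<nu> r f y * ennreal (1 - exp (- \<alpha> * r)) \<partial>lborel)"
proof -
  have [measurable]: "(\<lambda>t. trans_op \<nu> (max 0 t) f y) \<in> borel_measurable borel"
    by (rule trans_op_time_measurable) fact
  have [measurable]: "(\<lambda>t. trans_op \<nu> (max 0 t) (resolvent \<nu> \<beta> f) y) \<in> borel_measurable borel"
    by (rule trans_op_time_measurable) simp
  define k where "k r = ennreal (exp (- \<beta> * r)) * trans_op \<nu> (max 0 r) f y" for r
  have [measurable]: "k \<in> borel_measurable borel" unfolding k_def by measurable
  have "ennreal \<alpha> * resolvent \<nu> (\<beta> + \<alpha>) (resolvent \<nu> \<beta> f) y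
    = (\<integral>\<^sup>+s. ennreal \<alpha> * (ennreal (exp (- (\<beta> + \<alpha>) * s)) * trans_op \<nu> (max 0 s) (resolvent \<nu> \<beta> f) y * indicator {0..} s) \<partial>lborel)"
    unfolding resolvent_eq[of "\<beta> + \<alpha>"] by (rule nn_integral_cmult[symmetric]) simp
  also have "\<dots> = (\<integral>\<^sup>+s. (\<integral>\<^sup>+r. ennreal (\<alpha> * exp (- \<alpha> * s)) * indicator {0..} s * (k r * indicator {s..} r) \<partial>lborel) \<partial>lborel)"
  proof (rule nn_integral_cong)
    fix s :: real
    show "ennreal \<alpha> * (ennreal (exp (- (\<beta> + \<alpha>) * s)) * trans_op \<nu> (max 0 s) (resolvent \<nu> \<beta> f) y * indicator {0..} s)
      = (\<integral>\<^sup>+r. ennreal (\<alpha> * exp (- \<alpha> * s)) * indicator {0..} s * (k r * indicator {s..} r) \<partial>lborel)"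
    proof (cases "s \<ge> 0")
      case True
      have "(\<integral>\<^sup>+r. k r * indicator {s..} r \<partial>lborel) = ennreal (exp (- \<beta> * s)) * trans_op \<nu> s (resolvent \<nu> \<beta> f) y"
        unfolding trans_op_resolvent[OF f True] using True
        by (intro nn_integral_cong) (auto simp: k_def max_def split: split_indicator)
      then have "(\<integral>\<^sup>+r. ennreal (\<alpha> * exp (- \<alpha> * s)) * indicator {0..} s * (k r * indicator {s..} r) \<partial>lborel)
        = ennreal (\<alpha> * exp (- \<alpha> * s)) * (ennreal (exp (- \<beta> * s)) * trans_op \<nu> s (resolvent \<nu> \<beta> f) y)"
        using True by (simp add: nn_integral_cmult)
      also have "\<dots> = ennreal \<alpha> * (ennreal (exp (- \<alpha> * s + - \<beta> * s)) * trans_op \<nu> s (resolvent \<nu> \<beta> f) y)"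
        using \<alpha> by (simp only: ennreal_mult'' exp_ge_zero mult.assoc ennreal_exp_mult)
      finally show ?thesis using True by (simp add: algebra_simps)
    qed simp
  qed
  also have "\<dots> = (\<integral>\<^sup>+r. (\<integral>\<^sup>+s. ennreal (\<alpha> * exp (- \<alpha> * s)) * indicator {0..} s * (k r * indicator {s..} r) \<partial>lborel) \<partial>lborel)"
    by (rule lborel_pair.Fubini') (simp add: case_prod_beta atLeast_def)
  also have "\<dots> = (\<integral>\<^sup>+r\<in>{0..}. ennreal (exp (- \<beta> * r)) * trans_op \<nu> r f y * ennreal (1 - exp (- \<alpha> * r)) \<partial>lborel)"
  proof (rule nn_integral_cong)
    fix r :: real
    have "(\<integral>\<^sup>+s. ennreal (\<alpha> * exp (- \<alpha> * s)) * indicator {0..} s * (k r * indicator {s..} r) \<partial>lborel)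
      = (\<integral>\<^sup>+s. k r * (ennreal (\<alpha> * exp (- \<alpha> * s)) * indicator {0..r} s) \<partial>lborel)"
      by (rule nn_integral_cong) (auto simp: mult_ac split: split_indicator)
    also have "\<dots> = k r * (\<integral>\<^sup>+s. ennreal (\<alpha> * exp (- \<alpha> * s)) * indicator {0..r} s \<partial>lborel)"
      by (rule nn_integral_cmult) simp
    also have "\<dots> = k r * (ennreal (1 - exp (- \<alpha> * r)) * indicator {0..} r)"
    proof (cases "r \<ge> 0")
      case True
      have "(\<integral>\<^sup>+s. ennreal (\<alpha> * exp (- \<alpha> * s)) * indicator {0..r} s \<partial>lborel) = - exp (- \<alpha> * r) - (- exp (- \<alpha> * 0))"
        using \<alpha> True by (intro nn_integral_FTC_Icc) (auto intro!: derivative_eq_intros)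
      then show ?thesis using True by simp
    qed simp
    finally show "(\<integral>\<^sup>+s. ennreal (\<alpha> * exp (- \<alpha> * s)) * indicator {0..} s * (k r * indicator {s..} r) \<partial>lborel)
      = ennreal (exp (- \<beta> * r)) * trans_op \<nu> r f y * ennreal (1 - exp (- \<alpha> * r)) * indicator {0..} r"
      by (auto simp: k_def max_def mult_ac split: split_indicator)
  qed
  finally show ?thesis .
qed

text \<open>The weight in \<open>resolvent_resolvent\<close> is at most 1, which gives the
  inequality; for \<open>r > 0\<close> it tends to 1 as \<open>\<alpha>\<close> grows, which with
  Fatou's lemma gives the limit.\<close>

lemma excessive_resolvent:
  assumes f[measurable]: "f \<in> borel_measurable borel"
  shows "excessive \<nu> \<beta> (resolvent \<nu> \<beta> f)"
  unfolding excessive_def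
proof (intro conjI allI impI)
  show le: "ennreal \<alpha> * resolvent \<nu> (\<beta> + \<alpha>) (resolvent \<nu> \<beta> f) y \<le> resolvent \<nu> \<beta> f y" if "\<alpha> > 0" for \<alpha> y
    unfolding resolvent_resolvent[OF f that] unfolding resolvent_def
  proof (rule nn_integral_mono)
    fix r :: real
    have "ennreal (1 - exp (- \<alpha> * r)) \<le> 1" if "r \<ge> 0" by (simp add: ennreal_le_1)
    then show "ennreal (exp (- \<beta> * r)) * trans_op \<nu> r f y * ennreal (1 - exp (- \<alpha> * r)) * indicator {0..} r
      \<le> ennreal (exp (- \<beta> * r)) * trans_op \<nu> r f y * indicator {0..} r"
      by (auto split: split_indicator intro: mult_left_le)
  qed
  fix y
  have [measurable]: "(\<lambda>t. trans_op \<nu> (max 0 t) f y) \<in> borel_measurable borel"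
    by (rule trans_op_time_measurable) fact
  define k where "k r = ennreal (exp (- \<beta> * r)) * trans_op \<nu> (max 0 r) f y * indicator {0..} r" for r
  have [measurable]: "k \<in> borel_measurable borel" unfolding k_def by measurable
  have k: "resolvent \<nu> \<beta> f y = (\<integral>\<^sup>+r. k r \<partial>lborel)" unfolding resolvent_eq k_def ..
  have k': "ennreal \<alpha> * resolvent \<nu> (\<beta> + \<alpha>) (resolvent \<nu> \<beta> f) y
      = (\<integral>\<^sup>+r. k r * ennreal (1 - exp (- \<alpha> * r)) \<partial>lborel)" if "\<alpha> > 0" for \<alpha>
    unfolding resolvent_resolvent[OF f that] k_def
    by (intro nn_integral_cong) (auto simp: max_def mult_ac split: split_indicator)
  show "((\<lambda>\<alpha>. ennreal \<alpha> * resolvent \<nu> (\<beta> + \<alpha>) (resolvent \<nu> \<beta> f) y) \<longlongrightarrow> resolvent \<nu> \<beta> f y) at_top"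
  proof (rule tendsto_at_topI_sequentially)
    \<comment> \<open>Fatou's lemma works along sequences, so the limit is tested on an arbitrary
      sequence going to infinity.\<close>
    fix A :: "nat \<Rightarrow> real" assume A: "filterlim A at_top sequentially"
    then have pos: "\<forall>\<^sub>F n in sequentially. A n > 0" by (simp add: filterlim_at_top_dense)
    have pt: "(\<lambda>n. k r * ennreal (1 - exp (- A n * r))) \<longlonglongrightarrow> k r" if "r > 0" for r
    proof -
      have "filterlim (\<lambda>n. - A n * r) at_bot sequentially"
        using filterlim_tendsto_pos_mult_at_top[OF tendsto_const that A]
        by (simp add: filterlim_uminus_at_bot mult.commute)
      from filterlim_compose[OF exp_at_bot this]
      have "(\<lambda>n. ennreal (1 - exp (- A n * r))) \<longlonglongrightarrow> ennreal (1 - 0)"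
        by (intro tendsto_ennrealI tendsto_intros)
      then have "(\<lambda>n. k r * ennreal (1 - exp (- A n * r))) \<longlonglongrightarrow> k r * ennreal (1 - 0)"
        by (intro tendsto_mult_ennreal tendsto_const) auto
      then show ?thesis by simp
    qed
    have "(\<integral>\<^sup>+r. k r \<partial>lborel) = (\<integral>\<^sup>+r. liminf (\<lambda>n. k r * ennreal (1 - exp (- A n * r))) \<partial>lborel)"
    proof (rule nn_integral_cong_AE)
      \<comment> \<open>At \<open>r = 0\<close> the weight is 0 for every \<open>n\<close>, so the
        pointwise limit is claimed only almost everywhere; for \<open>r < 0\<close> the indicator
        inside \<open>k\<close> makes both sides 0.\<close>
      have "AE r in lborel. r \<noteq> (0::real)" by (rule AE_lborel_singleton)
      then show "AE r in lborel. k r = liminf (\<lambda>n. k r * ennreal (1 - exp (- A n * r)))"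
      proof eventually_elim
        case (elim r)
        show ?case
        proof (cases "r > 0")
          case True
          then show ?thesis using lim_imp_Liminf[OF _ pt[OF True]] by simp
        next
          case False
          then have "k r = 0" using elim by (simp add: k_def)
          then show ?thesis by (simp add: Liminf_const)
        qed
      qed
    qed
    also have "\<dots> \<le> liminf (\<lambda>n. \<integral>\<^sup>+r. k r * ennreal (1 - exp (- A n * r)) \<partial>lborel)"
      by (rule nn_integral_liminf) simp
    also have "\<dots> = liminf (\<lambda>n. ennreal (A n) * resolvent \<nu> (\<beta> + A n) (resolvent \<nu> \<beta> f) y)"
      by (rule Liminf_eq) (use pos in \<open>eventually_elim, simp add: k'\<close>)
    finally have 1: "resolvent \<nu> \<beta> f y \<le> liminf (\<lambda>n. ennreal (A n) * resolvent \<nu> (\<beta> + A n) (resolvent \<nu> \<beta> f) y)"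
      unfolding k .
    have 2: "limsup (\<lambda>n. ennreal (A n) * resolvent \<nu> (\<beta> + A n) (resolvent \<nu> \<beta> f) y) \<le> resolvent \<nu> \<beta> f y"
      by (rule Limsup_bounded) (use pos in \<open>eventually_elim, simp add: le\<close>)
    show "(\<lambda>n. ennreal (A n) * resolvent \<nu> (\<beta> + A n) (resolvent \<nu> \<beta> f) y) \<longlonglongrightarrow> resolvent \<nu> \<beta> f y"
      using 1 2 Liminf_le_Limsup[OF sequentially_bot, of "\<lambda>n. ennreal (A n) * resolvent \<nu> (\<beta> + A n) (resolvent \<nu> \<beta> f) y"]
      by (auto simp: tendsto_iff_Liminf_eq_Limsup)
  qed
qed simp

text \<open>On the grid of mesh \<open>1 / 2 ^ m\<close> the discounted process is a
  supermartingale, so it reaches \<open>c > 0\<close> with probability at most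
  \<open>v y / c\<close>, uniformly in \<open>m\<close>. The grids are nested, so the bound survives
  the union over \<open>m\<close>, and letting \<open>c\<close> grow leaves a null set.\<close>

lemma supermedian_dyadic_bound:
  assumes v[measurable]: "v \<in> borel_measurable borel"
    and super: "\<And>s y. s \<ge> 0 \<Longrightarrow> ennreal (exp (- s)) * trans_op \<nu> s v y \<le> v y"
    and fin: "v y < \<infinity>"
  shows "AE \<omega> in P y. \<exists>c::nat. \<forall>m k. ennreal (exp (- (real k / 2 ^ m))) * v (X (real k / 2 ^ m) \<omega>) \<le> of_nat c"
proof -
  interpret prob_space "P y" by (rule prob_P)
  define Z where "Z m k \<omega> = ennreal (exp (- (real k / 2 ^ m))) * v (X (real k / 2 ^ m) \<omega>)" for m k \<omega>
  have [measurable]: "X (real k / 2 ^ m) \<in> borel_measurable M" for k m :: nat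
    by (rule X_measurable) simp
  have Z[measurable]: "Z m k \<in> borel_measurable M" for m k
    unfolding Z_def by measurable
  define D where "D c m = {\<omega>\<in>space (P y). \<exists>k. of_nat c \<le> Z m k \<omega>}" for c m :: nat
  have [measurable]: "D c m \<in> sets M" for c m
    unfolding D_def space_P by measurable
  have D: "of_nat c * emeasure (P y) (D c m) \<le> v y" for c m
  proof -
    have "of_nat c * emeasure (P y) (D c m) \<le> (\<integral>\<^sup>+\<omega>. Z m 0 \<omega> \<partial>P y)"
      unfolding D_def
    proof (rule maximal_inequality)
      fix k
      define t where "t = real k / 2 ^ m"
      define h where "h = 1 / (2 ^ m :: real)"
      have t: "t \<ge> 0" and h: "h \<ge> 0" and th: "real (Suc k) / 2 ^ m = t + h"
        by (auto simp: t_def h_def field_simps)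
      define A where "A = {\<omega>\<in>space (P y). \<forall>i\<le>k. Z m i \<omega> < of_nat c}"
      \<comment> \<open>Only grid times up to \<open>t\<close> occur in \<open>A\<close>; this is
        what permits the Markov property at \<open>t\<close>.\<close>
      have "A \<in> sets (F t)"
      proof -
        have [measurable]: "Z m i \<in> borel_measurable (F t)" if "i \<le> k" for i
        proof -
          have "X (real i / 2 ^ m) \<in> borel_measurable (F t)"
            using that by (intro X_measurable_F) (auto simp: t_def divide_right_mono)
          then show ?thesis unfolding Z_def by measurable
        qed
        have "A = {\<omega>\<in>space (F t). \<forall>i\<in>{..k}. Z m i \<omega> < of_nat c}"
          by (auto simp: A_def space_F t space_P)
        also have "\<dots> \<in> sets (F t)"
          by (intro sets.sets_Collect_finite_All) auto
        finally show ?thesis .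
      qed
      have [measurable]: "A \<in> sets M" unfolding A_def space_P by measurable
      have tm[measurable]: "trans_op \<nu> h v \<in> borel_measurable borel" using trans_op_measurable[OF v h] .
      have [measurable]: "X t \<in> borel_measurable M" "X (t + h) \<in> borel_measurable M"
        using t h by (auto intro: X_measurable)
      have "(\<integral>\<^sup>+\<omega>. indicator A \<omega> * Z m (Suc k) \<omega> \<partial>P y)
        = ennreal (exp (- (t + h))) * (\<integral>\<^sup>+\<omega>. indicator A \<omega> * v (X (t + h) \<omega>) \<partial>P y)"
        unfolding Z_def th by (subst nn_integral_cmult[symmetric]) (auto simp: mult_ac)
      also have "\<dots> = ennreal (exp (- (t + h))) * (\<integral>\<^sup>+\<omega>. indicator A \<omega> * trans_op \<nu> h v (X t \<omega>) \<partial>P y)"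
        using \<open>A \<in> sets (F t)\<close> by (simp add: markov_property t h)
      also have "\<dots> = (\<integral>\<^sup>+\<omega>. indicator A \<omega> * (ennreal (exp (- t)) * (ennreal (exp (- h)) * trans_op \<nu> h v (X t \<omega>))) \<partial>P y)"
        unfolding ennreal_exp_mult
        by (subst nn_integral_cmult[symmetric]) (auto simp: mult_ac intro!: nn_integral_cong)
      also have "\<dots> \<le> (\<integral>\<^sup>+\<omega>. indicator A \<omega> * Z m k \<omega> \<partial>P y)"
        unfolding Z_def t_def[symmetric] by (intro nn_integral_mono mult_left_mono super h) auto
      finally show "(\<integral>\<^sup>+\<omega>. indicator {\<omega>\<in>space (P y). \<forall>i\<le>k. Z m i \<omega> < of_nat c} \<omega> * Z m (Suc k) \<omega> \<partial>P y)
        \<le> (\<integral>\<^sup>+\<omega>. indicator {\<omega>\<in>space (P y). \<forall>i\<le>k. Z m i \<omega> < of_nat c} \<omega> * Z m k \<omega> \<partial>P y)"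
        by (simp add: A_def)
    qed simp
    also have "\<dots> = v y"
      using law_X[OF v, of 0 y] by (simp add: Z_def trans_op_def)
    finally show ?thesis .
  qed
  have inc: "incseq (D c)" for c
  proof (rule incseq_SucI, rule subsetI)
    fix m \<omega> assume "\<omega> \<in> D c m"
    then obtain k where k: "\<omega> \<in> space (P y)" "of_nat c \<le> Z m k \<omega>" by (auto simp: D_def)
    \<comment> \<open>Every time of grid \<open>m\<close> belongs to grid \<open>Suc m\<close>, with
      twice the index.\<close>
    have "Z m k \<omega> = Z (Suc m) (2 * k) \<omega>" by (simp add: Z_def)
    with k show "\<omega> \<in> D c (Suc m)" by (auto simp: D_def)
  qed
  have D': "of_nat c * emeasure (P y) (\<Union>m. D c m) \<le> v y" for c
    using inc by (subst SUP_emeasure_incseq[symmetric]) (auto simp: SUP_mult_left_ennreal intro!: SUP_least D)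
  \<comment> \<open>On \<open>N\<close> every level \<open>c\<close> is reached on some
    grid.\<close>
  define N where "N = (\<Inter>c. \<Union>m. D c m)"
  have [measurable]: "N \<in> sets M" unfolding N_def by measurable
  have N: "of_nat c * emeasure (P y) N \<le> v y" for c
    by (rule order_trans[OF mult_left_mono D']) (auto simp: N_def intro!: emeasure_mono)
  have "emeasure (P y) N = 0"
  proof -
    obtain a where a: "v y = ennreal a" "a \<ge> 0" using fin by (cases "v y") auto
    \<comment> \<open>A bound that is finite and the same for all natural \<open>c\<close> forces
      probability 0; finiteness of \<open>v y\<close> enters here.\<close>
    have "real c * prob N \<le> a" for c :: nat
      using N[of c] a by (simp add: emeasure_eq_measure ennreal_of_nat_eq_real_of_nat ennreal_mult'[symmetric])
    then have "prob N = 0"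
      by (metis less_eq_real_def measure_nonneg not_le reals_Archimedean3)
    then show ?thesis by (simp add: emeasure_eq_measure)
  qed
  then have "N \<in> null_sets (P y)" by (auto simp: null_sets_def)
  then show ?thesis
  proof (rule AE_I')
    show "{\<omega> \<in> space (P y). \<not> (\<exists>c::nat. \<forall>m k. ennreal (exp (- (real k / 2 ^ m))) * v (X (real k / 2 ^ m) \<omega>) \<le> of_nat c)} \<subseteq> N"
      unfolding Z_def[symmetric] by (auto simp: N_def D_def not_le less_imp_le) (meson less_imp_le)
  qed
qed

end

section \<open>Extended seminorms with integrable square\<close>

lemma nn_integral_exp_minus: "(\<integral>\<^sup>+t\<in>{0..}. ennreal (exp (- t)) \<partial>lborel) = 1"
  using nn_intergal_power_times_exp_Ici[of 0] by simp

text \<open>The constant 3 is \<open>fact 0 + fact 2\<close>, from the Gamma integrals of 1 and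
  \<open>t\<^sup>2\<close>.\<close>

lemma nn_integral_exp_minus_quadratic:
  assumes "C \<ge> 0"
  shows "(\<integral>\<^sup>+t\<in>{0..}. ennreal (exp (- t)) * ennreal (C * (1 + t\<^sup>2)) \<partial>lborel) = ennreal (3 * C)"
proof -
  have "(\<integral>\<^sup>+t\<in>{0..}. ennreal (exp (- t)) * ennreal (C * (1 + t\<^sup>2)) \<partial>lborel)
    = (\<integral>\<^sup>+t. ennreal C * (ennreal (t ^ 0 * exp (- t)) * indicator {0..} t + ennreal (t ^ 2 * exp (- t)) * indicator {0..} t) \<partial>lborel)"
    using assms
    by (intro nn_integral_cong)
       (auto simp: ennreal_plus[symmetric] ennreal_mult'[symmetric] algebra_simps simp del: ennreal_plus
         split: split_indicator)
  also have "\<dots> = ennreal C * (ennreal (fact 0) + ennreal (fact 2))"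
    by (simp add: nn_integral_cmult nn_integral_add nn_intergal_power_times_exp_Ici[of 2, simplified]
        nn_intergal_power_times_exp_Ici[of 0, simplified])
  also have "\<dots> = ennreal (3 * C)"
    using assms by (simp add: ennreal_mult mult.commute numeral_2_eq_2)
  finally show ?thesis .
qed

text \<open>\<open>Q\<close> abstracts the square of the functional q. \<open>Q_add\<close> and
  \<open>Q_minus\<close> retain its seminorm properties, \<open>Q_compact\<close> supplies the
  compactness of levels, and \<open>Q_moment\<close> is the form in which (H) enters.\<close>

locale cadlag_levy_seminorm = cadlag_levy \<nu> M F X \<theta> P
  for \<nu> :: "real \<Rightarrow> 'e::{real_normed_vector, polish_space} measure"
    and M :: "'w measure" and F :: "real \<Rightarrow> 'w measure"
    and X :: "real \<Rightarrow> 'w \<Rightarrow> 'e" and \<theta> :: "real \<Rightarrow> 'w \<Rightarrow> 'w" and P :: "'e \<Rightarrow> 'w measure" +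
  fixes Q :: "'e \<Rightarrow> ennreal" and C :: real
  assumes Q_add: "Q (y + w) \<le> 2 * Q y + 2 * Q w"
    and Q_minus: "Q (- w) = Q w"
    and Q_compact: "compact {y. Q y \<le> ennreal c}"
    and C_nonneg: "C \<ge> 0"
    and Q_moment: "t > 0 \<Longrightarrow> (\<integral>\<^sup>+w. Q w \<partial>\<nu> t) \<le> ennreal (C * (1 + t\<^sup>2))"
begin

section \<open>Comparison of \<open>Q\<close> with its resolvent\<close>

lemma Q_measurable [measurable]: "Q \<in> borel_measurable borel"
proof (rule borel_measurableI_le)
  fix c :: ennreal
  \<comment> \<open>Compact sublevel sets are closed, so \<open>Q\<close> is lower semicontinuous;
    for infinite \<open>c\<close> the set is the whole space.\<close>
  have "closed {y. Q y \<le> c}"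
    by (cases c) (auto intro: compact_imp_closed Q_compact)
  then show "{y \<in> space borel. Q y \<le> c} \<in> sets borel" by simp
qed

lemma Q_upper:
  assumes t: "t > 0"
  shows "trans_op \<nu> t Q y \<le> 2 * Q y + 2 * ennreal (C * (1 + t\<^sup>2))"
proof -
  interpret prob_space "\<nu> t" by (rule prob_nu[OF t])
  have [measurable_cong]: "sets (\<nu> t) = sets borel" by (rule sets_nu[OF t])
  have "trans_op \<nu> t Q y \<le> (\<integral>\<^sup>+w. 2 * Q y + 2 * Q w \<partial>\<nu> t)"
    unfolding trans_op_def using t by (auto intro!: nn_integral_mono Q_add)
  also have "\<dots> = 2 * Q y + 2 * (\<integral>\<^sup>+w. Q w \<partial>\<nu> t)"
    by (simp add: nn_integral_add nn_integral_cmult emeasure_space_1)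
  also have "\<dots> \<le> 2 * Q y + 2 * ennreal (C * (1 + t\<^sup>2))"
    by (intro add_left_mono mult_left_mono Q_moment t) simp
  finally show ?thesis .
qed

lemma Q_lower:
  assumes t: "t > 0"
  shows "Q y \<le> 2 * trans_op \<nu> t Q y + 2 * ennreal (C * (1 + t\<^sup>2))"
proof -
  interpret prob_space "\<nu> t" by (rule prob_nu[OF t])
  have [measurable_cong]: "sets (\<nu> t) = sets borel" by (rule sets_nu[OF t])
  have "Q y = (\<integral>\<^sup>+w. Q y \<partial>\<nu> t)" by (simp add: emeasure_space_1)
  also have "\<dots> \<le> (\<integral>\<^sup>+w. 2 * Q (y + w) + 2 * Q w \<partial>\<nu> t)"
  proof (rule nn_integral_mono)
    show "Q y \<le> 2 * Q (y + w) + 2 * Q w" for w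
      using Q_add[of "y + w" "- w"] by (simp add: Q_minus)
  qed
  also have "\<dots> = 2 * trans_op \<nu> t Q y + 2 * (\<integral>\<^sup>+w. Q w \<partial>\<nu> t)"
    using t by (simp add: nn_integral_add nn_integral_cmult trans_op_def)
  also have "\<dots> \<le> 2 * trans_op \<nu> t Q y + 2 * ennreal (C * (1 + t\<^sup>2))"
    by (intro add_left_mono mult_left_mono Q_moment t) simp
  finally show ?thesis .
qed

text \<open>\<open>6 * C\<close> is twice the Gamma constant \<open>3 * C\<close>. The value
  \<open>a\<close> may be infinite.\<close>

lemma nn_integral_exp_affine_quadratic:
  "(\<integral>\<^sup>+t\<in>{0..}. ennreal (exp (- t)) * (2 * a + 2 * ennreal (C * (1 + t\<^sup>2))) \<partial>lborel) = 2 * a + ennreal (6 * C)"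
proof -
  have "(\<integral>\<^sup>+t\<in>{0..}. ennreal (exp (- t)) * (2 * a + 2 * ennreal (C * (1 + t\<^sup>2))) \<partial>lborel)
    = (\<integral>\<^sup>+t. 2 * a * (ennreal (exp (- t)) * indicator {0..} t)
        + 2 * (ennreal (exp (- t)) * ennreal (C * (1 + t\<^sup>2)) * indicator {0..} t) \<partial>lborel)"
    by (intro nn_integral_cong) (simp add: distrib_left distrib_right mult_ac)
  also have "\<dots> = 2 * a * (\<integral>\<^sup>+t\<in>{0..}. ennreal (exp (- t)) \<partial>lborel)
      + 2 * (\<integral>\<^sup>+t\<in>{0..}. ennreal (exp (- t)) * ennreal (C * (1 + t\<^sup>2)) \<partial>lborel)"
    by (subst nn_integral_add) (simp_all add: nn_integral_cmult)
  also have "2 * (\<integral>\<^sup>+t\<in>{0..}. ennreal (exp (- t)) * ennreal (C * (1 + t\<^sup>2)) \<partial>lborel) = ennreal (6 * C)"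
    using C_nonneg by (simp only: nn_integral_exp_minus_quadratic) (simp add: ennreal_mult'[symmetric] ennreal_numeral[symmetric] del: ennreal_numeral)
  finally show ?thesis by (simp only: nn_integral_exp_minus) simp
qed

lemma resolvent_Q_upper: "resolvent \<nu> 1 Q y \<le> 2 * Q y + ennreal (6 * C)"
proof -
  have "resolvent \<nu> 1 Q y \<le> (\<integral>\<^sup>+t\<in>{0..}. ennreal (exp (- t)) * (2 * Q y + 2 * ennreal (C * (1 + t\<^sup>2))) \<partial>lborel)"
    unfolding resolvent_def
  proof (rule nn_integral_mono_AE)
    \<comment> \<open>\<open>Q_upper\<close> is stated for positive times; the remaining point
      \<open>t = 0\<close> is Lebesgue-null.\<close>
    have "AE t in lborel. t \<noteq> (0::real)" by (rule AE_lborel_singleton)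
    then show "AE t in lborel. ennreal (exp (- 1 * t)) * trans_op \<nu> t Q y * indicator {0..} t
       \<le> ennreal (exp (- t)) * (2 * Q y + 2 * ennreal (C * (1 + t\<^sup>2))) * indicator {0..} t"
      by eventually_elim (auto intro!: mult_left_mono Q_upper split: split_indicator)
  qed
  then show ?thesis by (simp only: nn_integral_exp_affine_quadratic)
qed

lemma resolvent_Q_lower: "Q y \<le> 2 * resolvent \<nu> 1 Q y + ennreal (6 * C)"
proof -
  have [measurable]: "(\<lambda>t. trans_op \<nu> (max 0 t) Q y) \<in> borel_measurable borel"
    by (rule trans_op_time_measurable) simp
  \<comment> \<open>The exponential density has mass 1, so \<open>Q y\<close> becomes an integral
    over \<open>t\<close> to which \<open>Q_lower\<close> applies under the integral sign.\<close>
  have "Q y = Q y * (\<integral>\<^sup>+t\<in>{0..}. ennreal (exp (- t)) \<partial>lborel)"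
    by (simp only: nn_integral_exp_minus mult_1_right)
  also have "\<dots> = (\<integral>\<^sup>+t. Q y * (ennreal (exp (- t)) * indicator {0..} t) \<partial>lborel)"
    by (simp add: nn_integral_cmult)
  \<comment> \<open>The term \<open>2 * 0\<close> keeps the second summand in the shape of
    \<open>nn_integral_exp_affine_quadratic\<close> with \<open>a = 0\<close>.\<close>
  also have "\<dots> \<le> (\<integral>\<^sup>+t. 2 * (ennreal (exp (- 1 * t)) * trans_op \<nu> (max 0 t) Q y * indicator {0..} t)
      + ennreal (exp (- t)) * (2 * 0 + 2 * ennreal (C * (1 + t\<^sup>2))) * indicator {0..} t \<partial>lborel)"
  proof (rule nn_integral_mono_AE)
    have "AE t in lborel. t \<noteq> (0::real)" by (rule AE_lborel_singleton)
    then show "AE t in lborel. Q y * (ennreal (exp (- t)) * indicator {0..} t)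
       \<le> 2 * (ennreal (exp (- 1 * t)) * trans_op \<nu> (max 0 t) Q y * indicator {0..} t)
      + ennreal (exp (- t)) * (2 * 0 + 2 * ennreal (C * (1 + t\<^sup>2))) * indicator {0..} t"
    proof eventually_elim
      case (elim t)
      show ?case
      proof (cases "t > 0")
        case True
        then have "ennreal (exp (- t)) * Q y \<le> ennreal (exp (- t)) * (2 * trans_op \<nu> t Q y + 2 * ennreal (C * (1 + t\<^sup>2)))"
          by (intro mult_left_mono Q_lower) auto
        then show ?thesis using True by (simp add: distrib_left mult_ac max_def)
      qed (use elim in simp)
    qed
  qed
  also have "\<dots> = 2 * resolvent \<nu> 1 Q y + ennreal (6 * C)"
    unfolding resolvent_eq
    by (subst nn_integral_add, simp, simp, subst nn_integral_exp_affine_quadratic) (simp add: nn_integral_cmult)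
  finally show ?thesis .
qed

section \<open>Translates, Lyapunov functions and invariance of paths\<close>

definition shifted_dom :: "'e \<Rightarrow> 'e set" where
  "shifted_dom z = {y. Q (y - z) < \<infinity>}"

definition lyapunov :: "'e \<Rightarrow> 'e \<Rightarrow> ennreal" where
  "lyapunov z y = resolvent \<nu> 1 Q (y - z)"

text \<open>The transition operators commute with translations. Each translate is therefore itself a
  resolvent, so excessivity and the supermedian property follow for every \<open>z\<close> from the
  general lemmas.\<close>

lemma lyapunov_eq_resolvent: "lyapunov z = resolvent \<nu> 1 (\<lambda>y. Q (y - z))"
proof -
  have "y - z + w = y + w - z" for y w by simp
  then show ?thesis by (simp only: lyapunov_def[abs_def] resolvent_def[abs_def] trans_op_def)
qed

lemma lyapunov_measurable [measurable]: "lyapunov z \<in> borel_measurable borel"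
  unfolding lyapunov_eq_resolvent by measurable

lemma lyapunov_finite: "shifted_dom z = {y. lyapunov z y < \<infinity>}"
proof -
  have "Q y < \<infinity> \<longleftrightarrow> resolvent \<nu> 1 Q y < \<infinity>" for y
    using le_less_trans[OF resolvent_Q_upper[of y]] le_less_trans[OF resolvent_Q_lower[of y]]
    by (auto simp: ennreal_mult_less_top)
  then show ?thesis by (simp add: shifted_dom_def lyapunov_def)
qed

lemma compact_shifted_level: "compact {y. Q (y - z) \<le> ennreal c}"
proof -
  have "{y. Q (y - z) \<le> ennreal c} = (\<lambda>y. z + y) ` {y. Q y \<le> ennreal c}"
    by (auto simp: image_iff intro!: exI[of _ "_ - z"])
  then show ?thesis using compact_translation[OF Q_compact] by simp
qed

lemma lyapunov_level_subset:
  assumes "a \<ge> 0"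
  shows "{y. lyapunov z y \<le> ennreal a} \<subseteq> {y. Q (y - z) \<le> ennreal (2 * a + 6 * C)}"
proof safe
  fix y assume "lyapunov z y \<le> ennreal a"
  then have "2 * resolvent \<nu> 1 Q (y - z) + ennreal (6 * C) \<le> 2 * ennreal a + ennreal (6 * C)"
    unfolding lyapunov_def by (intro add_right_mono mult_left_mono) auto
  also have "\<dots> = ennreal (2 * a + 6 * C)"
    using assms C_nonneg by (simp add: ennreal_mult ennreal_plus)
  finally show "Q (y - z) \<le> ennreal (2 * a + 6 * C)"
    using resolvent_Q_lower order_trans by blast
qed

text \<open>The levels of \<open>Q\<close> are closed, so they contain the closures of the Lyapunov
  levels, which are then closed subsets of compact sets.\<close>

lemma compact_lyapunov: "compact_lyapunov \<nu> (lyapunov z)"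
  unfolding compact_lyapunov_def
proof (intro conjI allI impI)
  show "excessive \<nu> 1 (lyapunov z)"
    unfolding lyapunov_eq_resolvent by (rule excessive_resolvent) simp
  fix a :: real assume "a > 0"
  let ?K = "{y. Q (y - z) \<le> ennreal (2 * a + 6 * C)}"
  have "closure {y. lyapunov z y \<le> ennreal a} \<subseteq> ?K"
    using \<open>a > 0\<close> by (intro closure_minimal lyapunov_level_subset compact_imp_closed compact_shifted_level) auto
  then show "compact (closure {y. lyapunov z y \<le> ennreal a})"
    using compact_Int_closed[OF compact_shifted_level closed_closure] by (metis inf.absorb_iff2)
qed

text \<open>The moment bound makes \<open>Q w\<close> finite for almost every jump \<open>w\<close>,
  and adding or removing such a \<open>w\<close> does not change whether \<open>Q\<close> is
  finite.\<close>

lemma shifted_dom_invariant: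
  assumes t: "t > 0"
  shows "trans_op \<nu> t (indicator (shifted_dom z)) = indicator (shifted_dom z)"
proof
  fix y
  interpret prob_space "\<nu> t" by (rule prob_nu[OF t])
  have [measurable_cong]: "sets (\<nu> t) = sets borel" by (rule sets_nu[OF t])
  have "(\<integral>\<^sup>+w. Q w \<partial>\<nu> t) \<noteq> \<infinity>"
    using Q_moment[OF t] by (auto simp: top_unique)
  then have "AE w in \<nu> t. Q w \<noteq> \<infinity>"
    by (intro nn_integral_noteq_infinite) auto
  then have "AE w in \<nu> t. indicator (shifted_dom z) (y + w) = (indicator (shifted_dom z) y :: ennreal)"
  proof eventually_elim
    case (elim w)
    have "Q (y + w - z) < \<infinity> \<longleftrightarrow> Q (y - z) < \<infinity>"
      using le_less_trans[OF Q_add[of "y - z" w], of \<infinity>] le_less_trans[OF Q_add[of "y + w - z" "- w"], of \<infinity>] elim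
      by (auto simp: Q_minus ennreal_mult_less_top less_top algebra_simps)
    then show ?case by (simp add: shifted_dom_def indicator_def)
  qed
  then have "(\<integral>\<^sup>+w. indicator (shifted_dom z) (y + w) \<partial>\<nu> t) = (\<integral>\<^sup>+w. indicator (shifted_dom z) y \<partial>\<nu> t)"
    by (rule nn_integral_cong_AE)
  then show "trans_op \<nu> t (indicator (shifted_dom z)) y = indicator (shifted_dom z) y"
    using t by (simp add: trans_op_def emeasure_space_1)
qed

lemma paths_in_shifted_dom:
  assumes "y \<in> shifted_dom z"
  shows "AE \<omega> in P y. cadlag_in (top_of_set (shifted_dom z)) (\<lambda>t. X t \<omega>) \<and> (\<forall>t\<ge>0. X t \<omega> \<in> shifted_dom z)"
proof -
  have "AE \<omega> in P y. \<exists>c::nat. \<forall>m k. ennreal (exp (- (real k / 2 ^ m))) * lyapunov z (X (real k / 2 ^ m) \<omega>) \<le> of_nat c"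
  proof (rule supermedian_dyadic_bound)
    show "ennreal (exp (- s)) * trans_op \<nu> s (lyapunov z) y \<le> lyapunov z y" if "s \<ge> 0" for s y
      using resolvent_supermedian[of "\<lambda>y. Q (y - z)" s 1 y] that by (simp add: lyapunov_eq_resolvent)
  qed (use assms in \<open>auto simp: lyapunov_finite\<close>)
  with AE_space show ?thesis
  proof eventually_elim
    case (elim \<omega>)
    then obtain c :: nat
      where c: "\<And>m k. ennreal (exp (- (real k / 2 ^ m))) * lyapunov z (X (real k / 2 ^ m) \<omega>) \<le> of_nat c" by blast
    have "cadlag_in euclidean (\<lambda>t. X t \<omega>)"
      using elim by (intro cadlag_X) (simp add: space_P)
    moreover have "\<exists>K. closed K \<and> K \<subseteq> shifted_dom z \<and> (\<forall>m k. real k / 2 ^ m \<le> real N \<longrightarrow> X (real k / 2 ^ m) \<omega> \<in> K)" for N :: nat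
    proof (intro exI conjI allI impI)
      \<comment> \<open>Up to time \<open>N\<close> undoing the discount costs at most
        \<open>exp (real N)\<close>, so the Lyapunov function stays below
        \<open>exp (real N) * real c\<close>; the factor 2 and the term \<open>6 * C\<close> pass
        from it to \<open>Q\<close>, whose levels are known to be closed.\<close>
      let ?K = "{y. Q (y - z) \<le> ennreal (2 * (exp (real N) * real c) + 6 * C)}"
      show "closed ?K" by (intro compact_imp_closed compact_shifted_level)
      show "?K \<subseteq> shifted_dom z" by (auto simp: shifted_dom_def intro: le_less_trans)
      fix m k :: nat
      define t where "t = real k / 2 ^ m"
      assume "real k / 2 ^ m \<le> real N"
      have "lyapunov z (X t \<omega>) = ennreal (exp t) * (ennreal (exp (- t)) * lyapunov z (X t \<omega>))"
        by (simp add: ennreal_exp_mult)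
      also have "\<dots> \<le> ennreal (exp (real N)) * ennreal (real c)"
        using c[of k m] \<open>real k / 2 ^ m \<le> real N\<close>
        by (intro mult_mono) (auto simp: t_def ennreal_of_nat_eq_real_of_nat intro!: ennreal_leI)
      finally have "lyapunov z (X t \<omega>) \<le> ennreal (exp (real N) * real c)"
        by (simp add: ennreal_mult)
      then show "X (real k / 2 ^ m) \<omega> \<in> ?K"
        using lyapunov_level_subset[of "exp (real N) * real c" z] by (auto simp: t_def)
    qed
    ultimately show ?case
      using cadlag_in_top_of_set[of "\<lambda>t. X t \<omega>" "shifted_dom z"] by blast
  qed
qed

end

section \<open>Ellipsoids in a Hilbert space\<close>

lemma orthonormal_basis_seq_inner:
  assumes "orthonormal_basis_seq b"
  shows "inner (b m) (b n) = (if m = n then 1 else 0)"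
proof (cases "m = n")
  case True
  then show ?thesis
    using assms by (auto simp: orthonormal_basis_seq_def orthonormal_basis_def norm_eq_1)
next
  case False
  then have "b m \<noteq> b n" using assms by (auto simp: orthonormal_basis_seq_def dest: injD)
  then show ?thesis
    using assms False by (auto simp: orthonormal_basis_seq_def orthonormal_basis_def pairwise_def orthogonal_def)
qed

text \<open>The remainder \<open>z - p\<close> is orthogonal to the span, which contains
  \<open>p - y\<close>; Pythagoras then applies to their sum \<open>z - y\<close>.\<close>

lemma projection_minimises_distance:
  fixes b :: "nat \<Rightarrow> 'a::real_inner"
  assumes b: "\<And>m n. inner (b m) (b n) = (if m = n then 1 else 0)"
    and y: "y \<in> span (b ` {..<K})"
  shows "norm (z - (\<Sum>n<K. inner (b n) z *\<^sub>R b n)) \<le> norm (z - y)"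
proof -
  define p where "p = (\<Sum>n<K. inner (b n) z *\<^sub>R b n)"
  have "p \<in> span (b ` {..<K})"
    unfolding p_def by (intro span_sum span_scale span_base) auto
  then have py: "p - y \<in> span (b ` {..<K})" using y by (rule span_diff)
  have "orthogonal (z - p) (p - y)"
  proof (rule orthogonal_to_span[OF py])
    fix v assume "v \<in> b ` {..<K}"
    then obtain m where m: "v = b m" "m < K" by auto
    have "inner (b m) p = inner (b m) z"
      using m by (simp add: p_def inner_sum_right b if_distrib[where f="\<lambda>x. _ * x"] cong: if_cong)
    then show "orthogonal (z - p) v"
      by (simp add: orthogonal_def m inner_diff_right inner_commute[of _ "b m"])
  qed
  from norm_add_Pythagorean[OF this] have "(norm (z - p))\<^sup>2 \<le> (norm (z - y))\<^sup>2"
    by simp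
  then show ?thesis unfolding p_def by simp
qed

lemma norm_orthonormal_sum:
  fixes b :: "nat \<Rightarrow> 'a::real_inner"
  assumes b: "\<And>m n. inner (b m) (b n) = (if m = n then 1 else 0)" and "finite I"
  shows "(norm (\<Sum>n\<in>I. c n *\<^sub>R b n))\<^sup>2 = (\<Sum>n\<in>I. (c n)\<^sup>2)"
  using \<open>finite I\<close>
  unfolding power2_norm_eq_inner
  by (simp add: inner_sum_left inner_sum_right b power2_eq_square if_distrib[where f="\<lambda>x. _ * x"] cong: if_cong)

text \<open>Density of the span approximates \<open>z\<close> up to \<open>\<delta>\<close> by a
  finite combination, and a projection onto sufficiently many basis vectors is at least as close.
  The coordinates from \<open>N\<close> on contribute at most \<open>c / a N\<close> to the squared
  norm because \<open>a\<close> is increasing.\<close>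

lemma projection_remainder_bound:
  fixes b :: "nat \<Rightarrow> 'a::real_inner" and a :: "nat \<Rightarrow> real"
  assumes b: "orthonormal_basis_seq b" and a: "\<And>n. a n > 0" "incseq a"
    and z: "\<And>N. (\<Sum>n<N. a n * (inner (b n) z)\<^sup>2) \<le> c"
  shows "norm (z - (\<Sum>n<N. inner (b n) z *\<^sub>R b n)) \<le> sqrt (c / a N)"
proof (rule field_le_epsilon)
  note inner_b = orthonormal_basis_seq_inner[OF b]
  define p where "p I = (\<Sum>n\<in>I. inner (b n) z *\<^sub>R b n)" for I
  fix \<delta> :: real assume "\<delta> > 0"
  have "z \<in> closure (span (range b))"
    using b by (simp add: orthonormal_basis_seq_def orthonormal_basis_def)
  then obtain y where y: "y \<in> span (range b)" "dist y z < \<delta>"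
    using \<open>\<delta> > 0\<close> by (auto simp: closure_approachable)
  then obtain t r where t: "finite t" "t \<subseteq> range b" "y = (\<Sum>v\<in>t. r v *\<^sub>R v)"
    by (auto simp: span_explicit)
  then obtain I where I: "finite I" "t = b ` I"
    by (meson finite_subset_image subset_UNIV)
  obtain K0 where K0: "I \<subseteq> {..<K0}" using finite_nat_iff_bounded I(1) by blast
  \<comment> \<open>\<open>K\<close> is large enough to cover the approximant and to reach
    \<open>N\<close>, so the coordinates below \<open>K\<close> split at \<open>N\<close>.\<close>
  define K where "K = max K0 N"
  have "y \<in> span (b ` {..<K})"
    unfolding t(3) by (intro span_sum span_scale span_base) (use I K0 K_def in auto)
  from projection_minimises_distance[OF inner_b this, of z]
  have 1: "norm (z - p {..<K}) \<le> \<delta>"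
    using y(2) by (simp add: p_def dist_norm norm_minus_commute)
  have "{..<K} = {..<N} \<union> {N..<K}" by (auto simp: K_def)
  then have split: "p {..<K} = p {..<N} + p {N..<K}"
    by (simp add: p_def sum.union_disjoint ivl_disj_int)
  have "a N * (norm (p {N..<K}))\<^sup>2 = (\<Sum>n\<in>{N..<K}. a N * (inner (b n) z)\<^sup>2)"
    unfolding p_def by (simp add: norm_orthonormal_sum[OF inner_b] sum_distrib_left)
  also have "\<dots> \<le> (\<Sum>n\<in>{N..<K}. a n * (inner (b n) z)\<^sup>2)"
    using a(2) by (intro sum_mono mult_right_mono) (auto simp: incseq_def)
  also have "\<dots> \<le> (\<Sum>n<K. a n * (inner (b n) z)\<^sup>2)"
    using a(1) by (intro sum_mono2) (auto simp: less_imp_le)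
  also have "\<dots> \<le> c" by (rule z)
  finally have "(norm (p {N..<K}))\<^sup>2 \<le> c / a N"
    using a(1)[of N] by (simp add: field_simps)
  then have 2: "norm (p {N..<K}) \<le> sqrt (c / a N)"
    by (rule real_le_rsqrt)
  have "z - p {..<N} = (z - p {..<K}) + p {N..<K}" using split by simp
  then have "norm (z - p {..<N}) \<le> norm (z - p {..<K}) + norm (p {N..<K})"
    by (metis norm_triangle_ineq)
  with 1 2 have "norm (z - p {..<N}) \<le> sqrt (c / a N) + \<delta>" by linarith
  then show "norm (z - (\<Sum>n<N. inner (b n) z *\<^sub>R b n)) \<le> sqrt (c / a N) + \<delta>"
    by (simp add: p_def)
qed

text \<open>Each further coordinate adds a compact segment, and a sum of two compact sets is
  compact.\<close>

lemma compact_box_span: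
  fixes b :: "nat \<Rightarrow> 'a::real_normed_vector"
  shows "compact {(\<Sum>n<N. c n *\<^sub>R b n) | c. \<forall>n. \<bar>c n\<bar> \<le> r}"
proof (induction N)
  case 0
  \<comment> \<open>Only an inclusion holds: for negative \<open>r\<close> no \<open>c\<close> is
    admissible and the set is empty.\<close>
  have "{(\<Sum>n<0. c n *\<^sub>R b n) | c. \<forall>n. \<bar>c n\<bar> \<le> r} \<subseteq> {0}" by auto
  then show ?case by (meson finite.emptyI finite_insert finite_imp_compact finite_subset)
next
  case (Suc N)
  let ?S = "{(\<Sum>n<N. c n *\<^sub>R b n) | c. \<forall>n. \<bar>c n\<bar> \<le> r}" and ?T = "(\<lambda>s. s *\<^sub>R b N) ` {-r..r}"
  have "compact ?T"
    by (intro compact_continuous_image continuous_intros) simp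
  then have "compact {u + v | u v. u \<in> ?S \<and> v \<in> ?T}"
    using Suc.IH by (intro compact_sums)
  also have "{u + v | u v. u \<in> ?S \<and> v \<in> ?T} = {(\<Sum>n<Suc N. c n *\<^sub>R b n) | c. \<forall>n. \<bar>c n\<bar> \<le> r}"
  proof (intro equalityI subsetI)
    fix w assume "w \<in> {u + v | u v. u \<in> ?S \<and> v \<in> ?T}"
    then obtain c s where w: "w = (\<Sum>n<N. c n *\<^sub>R b n) + s *\<^sub>R b N" "\<forall>n. \<bar>c n\<bar> \<le> r" "\<bar>s\<bar> \<le> r"
      by (auto simp: abs_le_iff)
    then have "w = (\<Sum>n<Suc N. (c(N := s)) n *\<^sub>R b n)" "\<forall>n. \<bar>(c(N := s)) n\<bar> \<le> r" by auto
    then show "w \<in> {(\<Sum>n<Suc N. c n *\<^sub>R b n) | c. \<forall>n. \<bar>c n\<bar> \<le> r}" by blast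
  next
    fix w assume "w \<in> {(\<Sum>n<Suc N. c n *\<^sub>R b n) | c. \<forall>n. \<bar>c n\<bar> \<le> r}"
    then obtain c where w: "w = (\<Sum>n<Suc N. c n *\<^sub>R b n)" and c: "\<forall>n. \<bar>c n\<bar> \<le> r" by blast
    then have "(\<Sum>n<N. c n *\<^sub>R b n) \<in> ?S" "c N *\<^sub>R b N \<in> ?T"
      by (auto simp: abs_le_iff minus_le_iff)
    then show "w \<in> {u + v | u v. u \<in> ?S \<and> v \<in> ?T}" using w by auto
  qed
  finally show ?case .
qed

text \<open>A closed subset of a complete space is compact once it is totally bounded. The first
  \<open>N\<close> coordinates lie in a compact box, and the remainder is uniformly small because
  \<open>a\<close> tends to infinity.\<close>

lemma compact_subset_ellipsoid:
  fixes b :: "nat \<Rightarrow> 'a::{real_inner, complete_space}" and a :: "nat \<Rightarrow> real"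
  assumes b: "orthonormal_basis_seq b"
    and a: "\<And>n. a n > 0" "incseq a" "filterlim a at_top sequentially"
    and S: "closed S" "\<And>z N. z \<in> S \<Longrightarrow> (\<Sum>n<N. a n * (inner (b n) z)\<^sup>2) \<le> c"
  shows "compact S"
  unfolding compact_eq_totally_bounded
proof (intro conjI allI impI)
  show "Topological_Spaces.complete S" using S(1) by (simp add: complete_eq_closed)
  fix \<epsilon> :: real assume \<epsilon>: "\<epsilon> > 0"
  \<comment> \<open>\<open>N\<close> is chosen so that the remainder bound
    \<open>sqrt (c / a N)\<close> is at most half of \<open>\<epsilon>\<close>.\<close>
  have "\<forall>\<^sub>F n in sequentially. a n \<ge> c / (\<epsilon> / 2)\<^sup>2"
    using a(3) by (simp add: filterlim_at_top)
  then obtain N where "a N \<ge> c / (\<epsilon> / 2)\<^sup>2" by (auto simp: eventually_sequentially)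
  then have "c / a N \<le> (\<epsilon> / 2)\<^sup>2" using \<epsilon> a(1)[of N] by (simp add: field_simps)
  then have N: "sqrt (c / a N) \<le> \<epsilon> / 2" using \<epsilon> real_sqrt_le_mono by fastforce
  \<comment> \<open>As \<open>a 0\<close> is the smallest weight, one side length serves for all
    coordinates.\<close>
  let ?K = "{(\<Sum>n<N. s n *\<^sub>R b n) | s. \<forall>n. \<bar>s n\<bar> \<le> sqrt (c / a 0)}"
  have "compact ?K" by (rule compact_box_span)
  then obtain k where k: "finite k" "?K \<subseteq> (\<Union>x\<in>k. ball x (\<epsilon> / 2))"
    unfolding compact_eq_totally_bounded using \<epsilon> by (meson half_gt_zero)
  have "S \<subseteq> (\<Union>x\<in>k. ball x \<epsilon>)"
  proof
    fix z assume z: "z \<in> S"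
    let ?p = "\<Sum>n<N. inner (b n) z *\<^sub>R b n"
    have "\<bar>inner (b n) z\<bar> \<le> sqrt (c / a 0)" for n
    proof -
      have "a 0 * (inner (b n) z)\<^sup>2 \<le> a n * (inner (b n) z)\<^sup>2"
        using a(2) by (intro mult_right_mono) (auto simp: incseq_def)
      also have "\<dots> \<le> (\<Sum>m<Suc n. a m * (inner (b m) z)\<^sup>2)"
        using a(1) by (intro member_le_sum) (auto simp: less_imp_le)
      also have "\<dots> \<le> c" using z by (rule S(2))
      finally have "(inner (b n) z)\<^sup>2 \<le> c / a 0" using a(1)[of 0] by (simp add: field_simps)
      then show ?thesis by (intro real_le_rsqrt) simp
    qed
    then have "?p \<in> ?K" by (intro CollectI exI[of _ "\<lambda>n. inner (b n) z"]) auto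
    then obtain x where x: "x \<in> k" "dist x ?p < \<epsilon> / 2" using k(2) by auto
    have "dist ?p z \<le> \<epsilon> / 2"
      using projection_remainder_bound[OF b a(1,2) S(2)[OF z], of N] N
      by (simp add: dist_norm norm_minus_commute)
    then have "dist x z < \<epsilon>" using x(2) dist_triangle[of x z ?p] by linarith
    then show "z \<in> (\<Union>x\<in>k. ball x \<epsilon>)" using x(1) by auto
  qed
  then show "\<exists>k. finite k \<and> S \<subseteq> (\<Union>x\<in>k. ball x \<epsilon>)" using k(1) by blast
qed

section \<open>The functional q and the theorem\<close>

text \<open>The definite description is legitimate: two continuous functionals that agree on the
  dense range of \<open>j\<close> coincide.\<close>

lemma dual_pairing_bounded_linear:
  assumes j: "dense_embedding j" and \<xi>: "\<xi> \<in> dual_in j"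
  shows "bounded_linear (dual_pairing j \<xi>)"
proof -
  obtain f :: "'b \<Rightarrow>\<^sub>L real" where f: "\<forall>k. blinfun_apply f (j k) = inner \<xi> k"
    using \<xi> by (auto simp: dual_in_def)
  have "g = f" if g: "\<forall>k. blinfun_apply g (j k) = inner \<xi> k" for g
  proof (rule blinfun_eqI)
    fix z
    have "closed {z. blinfun_apply g z = blinfun_apply f z}"
      by (intro closed_Collect_eq continuous_intros)
    moreover have "range j \<subseteq> {z. blinfun_apply g z = blinfun_apply f z}"
      using f g by auto
    ultimately have "closure (range j) \<subseteq> {z. blinfun_apply g z = blinfun_apply f z}"
      by (rule closure_minimal[rotated])
    then show "blinfun_apply g z = blinfun_apply f z"
      using j by (auto simp: dense_embedding_def)
  qed
  then have "(THE f. \<forall>k. blinfun_apply f (j k) = inner \<xi> k) = f"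
    using f by (rule the_equality[rotated])
  then have "dual_pairing j \<xi> = blinfun_apply f"
    by (simp add: dual_pairing_def[abs_def])
  then show ?thesis by (simp add: blinfun.bounded_linear_right)
qed

section \<open>Seminorm, closedness and moment properties of the square of q\<close>

lemma SUP_power2_ennreal:
  fixes r :: "nat \<Rightarrow> ennreal"
  assumes "incseq r"
  shows "(SUP n. r n)\<^sup>2 = (SUP n. (r n)\<^sup>2)"
proof (rule antisym)
  \<comment> \<open>Mixed products from squaring the supremum are dominated by a single square at
    the larger index.\<close>
  have "r i * r j \<le> (SUP n. (r n)\<^sup>2)" for i j
  proof -
    have "r i * r j \<le> r (max i j) * r (max i j)"
      using assms by (intro mult_mono) (auto simp: incseq_def)
    also have "\<dots> \<le> (SUP n. (r n)\<^sup>2)"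
      unfolding power2_eq_square by (rule SUP_upper) simp
    finally show ?thesis .
  qed
  then show "(SUP n. r n)\<^sup>2 \<le> (SUP n. (r n)\<^sup>2)"
    by (auto simp: power2_eq_square SUP_mult_left_ennreal SUP_mult_right_ennreal intro!: SUP_least)
  show "(SUP n. (r n)\<^sup>2) \<le> (SUP n. r n)\<^sup>2"
    by (intro SUP_least power_mono SUP_upper) auto
qed

text \<open>This is the square of \<open>q_fun\<close> with general weights and functionals; the
  value infinity remains possible.\<close>

definition qsum :: "(nat \<Rightarrow> real) \<Rightarrow> (nat \<Rightarrow> 'a \<Rightarrow> real) \<Rightarrow> (nat \<Rightarrow> real) \<Rightarrow> (nat \<Rightarrow> 'a \<Rightarrow> real) \<Rightarrow> 'a \<Rightarrow> ennreal" where
  "qsum a A b B z = (\<Sum>n. ennreal (a n * (A n z)\<^sup>2)) + (\<Sum>n. ennreal (b n * \<bar>B n z\<bar>))\<^sup>2"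

text \<open>Both series are suprema of increasing partial sums. A level set thus becomes an
  intersection of conditions on finite sums, which yields closedness and the ellipsoid
  estimate.\<close>

lemma qsum_le_iff:
  assumes a: "\<And>n. a n \<ge> 0" and b: "\<And>n. b n \<ge> 0"
  shows "qsum a A b B z \<le> c \<longleftrightarrow>
    (\<forall>N. ennreal ((\<Sum>n<N. a n * (A n z)\<^sup>2) + (\<Sum>n<N. b n * \<bar>B n z\<bar>)\<^sup>2) \<le> c)"
proof -
  have 1: "incseq (\<lambda>N. \<Sum>n<N. ennreal (a n * (A n z)\<^sup>2))"
    "incseq (\<lambda>N. \<Sum>n<N. ennreal (b n * \<bar>B n z\<bar>))"
    by (auto intro!: incseq_SucI)
  then have 2: "incseq (\<lambda>N. (\<Sum>n<N. ennreal (b n * \<bar>B n z\<bar>))\<^sup>2)"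
    by (auto simp: incseq_def intro!: power_mono)
  have "qsum a A b B z = (SUP N. (\<Sum>n<N. ennreal (a n * (A n z)\<^sup>2)) + (\<Sum>n<N. ennreal (b n * \<bar>B n z\<bar>))\<^sup>2)"
    unfolding qsum_def suminf_eq_SUP SUP_power2_ennreal[OF 1(2)] by (rule ennreal_SUP_add[OF 1(1) 2, symmetric])
  also have "\<dots> = (SUP N. ennreal ((\<Sum>n<N. a n * (A n z)\<^sup>2) + (\<Sum>n<N. b n * \<bar>B n z\<bar>)\<^sup>2))"
    using a b by (intro SUP_cong refl) (simp add: sum_ennreal ennreal_power sum_nonneg)
  finally show ?thesis by (simp add: SUP_le_iff)
qed

lemma closed_qsum_le:
  fixes A B :: "nat \<Rightarrow> 'a::real_normed_vector \<Rightarrow> real"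
  assumes a: "\<And>n. a n \<ge> 0" and b: "\<And>n. b n \<ge> 0"
    and A: "\<And>n. bounded_linear (A n)" and B: "\<And>n. bounded_linear (B n)"
  shows "closed {z. qsum a A b B z \<le> c}"
proof -
  note [continuous_intros] = bounded_linear.continuous_on[OF A] bounded_linear.continuous_on[OF B]
  show ?thesis
    unfolding qsum_le_iff[OF a b]
    by (intro closed_Collect_all closed_Collect_le continuous_intros continuous_on_ennreal)
qed

lemma qsum_minus:
  assumes A: "\<And>n. bounded_linear (A n)" and B: "\<And>n. bounded_linear (B n)"
  shows "qsum a A b B (- z) = qsum a A b B z"
  by (simp add: qsum_def bounded_linear.linear[OF A] bounded_linear.linear[OF B] linear_neg)

lemma ennreal_power2_add_le: "(x + y)\<^sup>2 \<le> 2 * x\<^sup>2 + 2 * (y :: ennreal)\<^sup>2"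
proof (cases "x = \<infinity> \<or> y = \<infinity>")
  case False
  then obtain r s where rs: "x = ennreal r" "y = ennreal s" "r \<ge> 0" "s \<ge> 0"
    by (cases x; cases y) auto
  have "(r + s)\<^sup>2 \<le> 2 * r\<^sup>2 + 2 * s\<^sup>2"
    using sum_squares_bound[of r s] by (simp add: power2_sum)
  then have "ennreal ((r + s)\<^sup>2) \<le> ennreal (2 * r\<^sup>2 + 2 * s\<^sup>2)" by (rule ennreal_leI)
  then show ?thesis
    using rs by (simp add: ennreal_power[symmetric] ennreal_mult)
qed (auto simp: power2_eq_square ennreal_mult_top ennreal_top_mult)

text \<open>The first series is estimated term by term with
  \<open>(r + s)\<^sup>2 \<le> 2 * r\<^sup>2 + 2 * s\<^sup>2\<close>; in the second the triangle
  inequality comes first and the same estimate is applied to the whole sum.\<close>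

lemma qsum_add:
  assumes a: "\<And>n. a n \<ge> 0" and b: "\<And>n. b n \<ge> 0"
    and A: "\<And>n. bounded_linear (A n)" and B: "\<And>n. bounded_linear (B n)"
  shows "qsum a A b B (y + w) \<le> 2 * qsum a A b B y + 2 * qsum a A b B w"
proof -
  let ?S = "\<lambda>z. \<Sum>n. ennreal (a n * (A n z)\<^sup>2)" and ?R = "\<lambda>z. \<Sum>n. ennreal (b n * \<bar>B n z\<bar>)"
  have "?S (y + w) \<le> (\<Sum>n. 2 * ennreal (a n * (A n y)\<^sup>2) + 2 * ennreal (a n * (A n w)\<^sup>2))"
  proof (intro suminf_le summableI)
    fix n
    have "(A n (y + w))\<^sup>2 \<le> 2 * (A n y)\<^sup>2 + 2 * (A n w)\<^sup>2"
      using sum_squares_bound[of "A n y" "A n w"]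
      by (simp add: linear_add[OF bounded_linear.linear[OF A]] power2_sum)
    then have "a n * (A n (y + w))\<^sup>2 \<le> a n * (2 * (A n y)\<^sup>2 + 2 * (A n w)\<^sup>2)"
      using a by (rule mult_left_mono)
    then have "ennreal (a n * (A n (y + w))\<^sup>2) \<le> ennreal (2 * (a n * (A n y)\<^sup>2) + 2 * (a n * (A n w)\<^sup>2))"
      by (intro ennreal_leI) (simp add: algebra_simps)
    then show "ennreal (a n * (A n (y + w))\<^sup>2) \<le> 2 * ennreal (a n * (A n y)\<^sup>2) + 2 * ennreal (a n * (A n w)\<^sup>2)"
      using a by (simp add: ennreal_mult)
  qed
  also have "\<dots> = 2 * ?S y + 2 * ?S w"
    by (simp add: suminf_add[symmetric] summableI)
  finally have S: "?S (y + w) \<le> 2 * ?S y + 2 * ?S w" .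
  have "?R (y + w) \<le> (\<Sum>n. ennreal (b n * \<bar>B n y\<bar>) + ennreal (b n * \<bar>B n w\<bar>))"
  proof (intro suminf_le summableI)
    fix n
    have "b n * \<bar>B n (y + w)\<bar> \<le> b n * (\<bar>B n y\<bar> + \<bar>B n w\<bar>)"
      using b by (intro mult_left_mono) (simp_all add: linear_add[OF bounded_linear.linear[OF B]])
    then have "ennreal (b n * \<bar>B n (y + w)\<bar>) \<le> ennreal (b n * \<bar>B n y\<bar> + b n * \<bar>B n w\<bar>)"
      by (intro ennreal_leI) (simp add: algebra_simps)
    then show "ennreal (b n * \<bar>B n (y + w)\<bar>) \<le> ennreal (b n * \<bar>B n y\<bar>) + ennreal (b n * \<bar>B n w\<bar>)"
      using b by simp
  qed
  also have "\<dots> = ?R y + ?R w"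
    by (simp add: suminf_add[symmetric] summableI)
  finally have "(?R (y + w))\<^sup>2 \<le> (?R y + ?R w)\<^sup>2" by (rule power_mono) simp
  also have "\<dots> \<le> 2 * (?R y)\<^sup>2 + 2 * (?R w)\<^sup>2" by (rule ennreal_power2_add_le)
  finally have "qsum a A b B (y + w) \<le> (2 * ?S y + 2 * ?S w) + (2 * (?R y)\<^sup>2 + 2 * (?R w)\<^sup>2)"
    unfolding qsum_def using S by (intro add_mono)
  also have "\<dots> = 2 * qsum a A b B y + 2 * qsum a A b B w"
    by (simp add: qsum_def distrib_left add_ac)
  finally show ?thesis .
qed

text \<open>Cauchy-Schwarz with weights \<open>b\<close> turns the squared series into a weighted
  series of squares, at the price of the factor \<open>suminf b\<close>. Both parts are then
  integrated term by term.\<close>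

lemma nn_integral_qsum_le:
  assumes a: "\<And>n. a n \<ge> 0" "summable a" and b: "\<And>n. b n \<ge> 0" "summable b"
    and [measurable]: "\<And>n. A n \<in> borel_measurable M" "\<And>n. B n \<in> borel_measurable M"
    and c: "c \<ge> 0"
    and A: "\<And>n. (\<integral>\<^sup>+z. ennreal ((A n z)\<^sup>2) \<partial>M) \<le> ennreal c"
    and B: "\<And>n. (\<integral>\<^sup>+z. ennreal ((B n z)\<^sup>2) \<partial>M) \<le> ennreal c"
  shows "(\<integral>\<^sup>+z. qsum a A b B z \<partial>M) \<le> ennreal ((suminf a + (suminf b)\<^sup>2) * c)"
proof -
  have cs: "(\<Sum>n. ennreal (b n * \<bar>B n z\<bar>))\<^sup>2 \<le> ennreal (suminf b) * (\<Sum>n. ennreal (b n * (B n z)\<^sup>2))" for z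
  proof -
    \<comment> \<open>Each weight is split into two square roots, and the series are read as
      integrals for counting measure.\<close>
    have "(\<integral>\<^sup>+n. ennreal (sqrt (b n)) * ennreal (sqrt (b n) * \<bar>B n z\<bar>) \<partial>count_space UNIV)\<^sup>2
      \<le> (\<integral>\<^sup>+n. (ennreal (sqrt (b n)))\<^sup>2 \<partial>count_space UNIV) * (\<integral>\<^sup>+n. (ennreal (sqrt (b n) * \<bar>B n z\<bar>))\<^sup>2 \<partial>count_space UNIV)"
      by (rule Cauchy_Schwarz_nn_integral) auto
    also have "(\<lambda>n. ennreal (sqrt (b n)) * ennreal (sqrt (b n) * \<bar>B n z\<bar>)) = (\<lambda>n. ennreal (b n * \<bar>B n z\<bar>))"
      using b by (simp add: ennreal_mult'[symmetric] mult.assoc[symmetric])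
    also have "(\<lambda>n. (ennreal (sqrt (b n)))\<^sup>2) = (\<lambda>n. ennreal (b n))"
      using b by (simp add: ennreal_power)
    also have "(\<lambda>n. (ennreal (sqrt (b n) * \<bar>B n z\<bar>))\<^sup>2) = (\<lambda>n. ennreal (b n * (B n z)\<^sup>2))"
      using b by (simp add: ennreal_power power_mult_distrib)
    finally show ?thesis
      using b by (simp add: nn_integral_count_space_nat suminf_ennreal2)
  qed
  have weighted: "(\<integral>\<^sup>+z. (\<Sum>n. ennreal (w n * (f n z)\<^sup>2)) \<partial>M) \<le> ennreal (suminf w * c)"
    if w: "\<And>n. w n \<ge> 0" "summable w" and [measurable]: "\<And>n. f n \<in> borel_measurable M"
      and f: "\<And>n. (\<integral>\<^sup>+z. ennreal ((f n z)\<^sup>2) \<partial>M) \<le> ennreal c" for w :: "nat \<Rightarrow> real" and f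
  proof -
    have "(\<integral>\<^sup>+z. (\<Sum>n. ennreal (w n * (f n z)\<^sup>2)) \<partial>M) = (\<Sum>n. ennreal (w n) * (\<integral>\<^sup>+z. ennreal ((f n z)\<^sup>2) \<partial>M))"
      using w by (simp add: nn_integral_suminf nn_integral_cmult ennreal_mult)
    also have "\<dots> \<le> (\<Sum>n. ennreal (w n) * ennreal c)"
      by (intro suminf_le summableI mult_left_mono f) simp
    also have "\<dots> = ennreal (suminf w * c)"
      using w c by (simp add: suminf_ennreal2 ennreal_mult suminf_nonneg)
    finally show ?thesis .
  qed
  have "(\<integral>\<^sup>+z. qsum a A b B z \<partial>M)
    \<le> (\<integral>\<^sup>+z. (\<Sum>n. ennreal (a n * (A n z)\<^sup>2)) + ennreal (suminf b) * (\<Sum>n. ennreal (b n * (B n z)\<^sup>2)) \<partial>M)"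
    unfolding qsum_def by (intro nn_integral_mono add_left_mono cs)
  also have "\<dots> = (\<integral>\<^sup>+z. (\<Sum>n. ennreal (a n * (A n z)\<^sup>2)) \<partial>M)
      + ennreal (suminf b) * (\<integral>\<^sup>+z. (\<Sum>n. ennreal (b n * (B n z)\<^sup>2)) \<partial>M)"
    by (simp add: nn_integral_add nn_integral_cmult)
  also have "\<dots> \<le> ennreal (suminf a * c) + ennreal (suminf b) * ennreal (suminf b * c)"
    by (intro add_mono mult_left_mono weighted a b A B) auto
  also have "\<dots> = ennreal (suminf a * c + suminf b * (suminf b * c))"
    using a b c by (simp add: ennreal_mult suminf_nonneg)
  also have "suminf a * c + suminf b * (suminf b * c) = (suminf a + (suminf b)\<^sup>2) * c"
    by (simp add: power2_eq_square algebra_simps)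
  finally show ?thesis .
qed

lemma ennreal_sqrt_power2: "(ennreal_sqrt a)\<^sup>2 = a"
  by (cases a) (auto simp: ennreal_sqrt_def ennreal_power)

text \<open>A geometric series of ratio \<open>2 powr (- 1 / 2)\<close>.\<close>

lemma summable_powr_half: "summable (\<lambda>n. 2 powr (- real (n + 1) / 2))"
proof -
  have "2 powr (- real (n + 1) / 2) = (2 powr (- 1 / 2)) ^ Suc n" for n
  proof -
    have "(2 powr (- 1 / 2)) ^ Suc n = 2 powr (real (Suc n) * (- 1 / 2))"
      by (rule powr_power) simp
    also have "real (Suc n) * (- 1 / 2) = - real (n + 1) / 2"
      by (simp add: field_simps)
    finally show ?thesis ..
  qed
  moreover have "summable (\<lambda>n. (2 powr (- 1 / 2)) ^ Suc n :: real)"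
    by (subst summable_Suc_iff) (simp add: summable_geometric powr_minus powr_half_sqrt inverse_eq_divide)
  ultimately show ?thesis by simp
qed

section \<open>Application to the functional q\<close>

theorem theorem3p4:
  fixes j :: "'h::{real_inner, banach, polish_space} \<Rightarrow> 'e::{real_inner, banach, polish_space}"
    and \<psi> :: "'h \<Rightarrow> complex"
    and \<nu> :: "real \<Rightarrow> 'e measure"
    and M :: "'w measure" and F :: "real \<Rightarrow> 'w measure"
    and X :: "real \<Rightarrow> 'w \<Rightarrow> 'e" and \<theta> :: "real \<Rightarrow> 'w \<Rightarrow> 'w" and P :: "'e \<Rightarrow> 'w measure"
    and e ex :: "nat \<Rightarrow> 'h" and lam \<alpha> :: "nat \<Rightarrow> real" and x :: 'e
  assumes "dense_embedding j"
    and "hilbert_schmidt j"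
    and "continuous_on UNIV \<psi>" and "negative_definite \<psi>" and "\<psi> 0 = 0"
    and "levy_measures j \<psi> \<nu>"
    and "hypothesis_H j \<nu>"
    and "cadlag_markov_process \<nu> M F X \<theta> P"
    and "basis_data j e lam \<alpha>"
    and "x \<notin> range j"
    and "basis_at j x ex"
  shows "\<forall>z. compact_lyapunov \<nu> (v_fun j \<nu> e lam \<alpha> ex z) \<and>
             E_shift j e lam \<alpha> ex z = {y. v_fun j \<nu> e lam \<alpha> ex z y < \<infinity>} \<and>
             (\<forall>t>0. trans_op \<nu> t (indicator (E_shift j e lam \<alpha> ex z))
                       = indicator (E_shift j e lam \<alpha> ex z)) \<and>
             (\<forall>y \<in> E_shift j e lam \<alpha> ex z.
                AE \<omega> in P y. \<forall>t\<ge>0. X t \<omega> \<in> E_shift j e lam \<alpha> ex z) \<and>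
             (\<forall>y \<in> E_shift j e lam \<alpha> ex z.
                AE \<omega> in P y. cadlag_in (top_of_set (E_shift j e lam \<alpha> ex z)) (\<lambda>t. X t \<omega>))"
proof -
  have lam: "lam n > 0" and \<alpha>: "\<alpha> n > 0" and e: "e n \<in> dual_in j"
    and pairing: "lam n * dual_pairing j (e n) z = inner (j (e n)) z" for n z
    using assms(9) by (auto simp: basis_data_def)
  have ex: "ex n \<in> dual_in j" for n
    using assms(11) by (auto simp: basis_at_def)
  \<comment> \<open>Unit norms make the moment bound of (H) the same for all basis vectors.\<close>
  have norm_basis: "norm (e n) = 1" "norm (ex n) = 1" for n
    using assms(9,11) by (auto simp: basis_data_def basis_at_def orthonormal_basis_seq_def orthonormal_basis_def)
  obtain C where C: "C > 0" "\<And>\<xi> t. \<xi> \<in> dual_in j \<Longrightarrow> t > 0 \<Longrightarrow>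
      (\<integral>\<^sup>+z. ennreal ((dual_pairing j \<xi> z)\<^sup>2) \<partial>(\<nu> t)) \<le> ennreal (C * (1 + t\<^sup>2) * (norm \<xi>)\<^sup>2)"
    using assms(7) by (auto simp: hypothesis_H_def)
  define a where "a n = \<alpha> n * lam n" for n
  define b :: "nat \<Rightarrow> real" where "b n = 2 powr (- real (n + 1) / 2)" for n
  define A where "A n = dual_pairing j (e n)" for n
  define B where "B n = dual_pairing j (ex n)" for n
  define Q where "Q = qsum a A b B"
  have a: "a n \<ge> 0" "summable a" for n
    using lam[of n] \<alpha>[of n] assms(9) by (auto simp: a_def[abs_def] basis_data_def less_imp_le)
  have b: "b n \<ge> 0" "summable b" for n
    using summable_powr_half by (auto simp: b_def[abs_def])
  have A: "bounded_linear (A n)" and B: "bounded_linear (B n)" for n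
    unfolding A_def B_def by (intro dual_pairing_bounded_linear assms(1) e ex)+
  have q: "(q_fun j e lam \<alpha> ex z)\<^sup>2 = Q z" for z
    by (simp only: q_fun_def ennreal_sqrt_power2 Q_def qsum_def a_def b_def A_def B_def)
  have compact_level: "compact {z. Q z \<le> ennreal c}" for c
  proof (rule compact_subset_ellipsoid)
    show "orthonormal_basis_seq (\<lambda>n. j (e n) /\<^sub>R sqrt (lam n))" "incseq \<alpha>" "filterlim \<alpha> at_top sequentially"
      using assms(9) by (auto simp: basis_data_def)
    show "closed {z. Q z \<le> ennreal c}"
      unfolding Q_def by (intro closed_qsum_le a b A B)
    fix z N assume "z \<in> {z. Q z \<le> ennreal c}"
    then have "ennreal ((\<Sum>n<N. a n * (A n z)\<^sup>2) + (\<Sum>n<N. b n * \<bar>B n z\<bar>)\<^sup>2) \<le> ennreal c"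
      by (simp add: Q_def qsum_le_iff a b)
    \<comment> \<open>\<open>ennreal\<close> sends negative reals to 0; the nonnegative bound
      \<open>max 0 c\<close> allows a return to a real inequality.\<close>
    also have "ennreal c \<le> ennreal (max 0 c)"
      by (rule ennreal_leI) simp
    finally have "(\<Sum>n<N. a n * (A n z)\<^sup>2) + (\<Sum>n<N. b n * \<bar>B n z\<bar>)\<^sup>2 \<le> max 0 c"
      by (subst (asm) ennreal_le_iff) simp_all
    then have "(\<Sum>n<N. a n * (A n z)\<^sup>2) \<le> max 0 c"
      by (rule order_trans[rotated]) simp
    also have "(\<Sum>n<N. a n * (A n z)\<^sup>2) = (\<Sum>n<N. \<alpha> n * (inner (j (e n) /\<^sub>R sqrt (lam n)) z)\<^sup>2)"
    proof (rule sum.cong)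
      fix n
      \<comment> \<open>The pairing with \<open>e n\<close> is, up to the factor
        \<open>sqrt (lam n)\<close>, the coordinate of \<open>z\<close> in the rescaled basis of E.
        The first series of q squared thus describes an ellipsoid with weights
        \<open>\<alpha> n\<close>.\<close>
      have "(inner (j (e n) /\<^sub>R sqrt (lam n)) z)\<^sup>2 = lam n * (A n z)\<^sup>2"
        using lam[of n] by (simp add: pairing[symmetric] A_def power_mult_distrib power_inverse power2_eq_square field_simps)
      then show "a n * (A n z)\<^sup>2 = \<alpha> n * (inner (j (e n) /\<^sub>R sqrt (lam n)) z)\<^sup>2"
        by (simp add: a_def)
    qed simp
    finally show "(\<Sum>n<N. \<alpha> n * (inner (j (e n) /\<^sub>R sqrt (lam n)) z)\<^sup>2) \<le> max 0 c" .
  qed (rule \<alpha>)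
  \<comment> \<open>This is the factor from \<open>nn_integral_qsum_le\<close> times the constant of
    (H); the time factor \<open>1 + t\<^sup>2\<close> is kept apart.\<close>
  define C' where "C' = (suminf a + (suminf b)\<^sup>2) * C"
  interpret cadlag_levy_seminorm \<nu> M F X \<theta> P Q C'
  proof (intro cadlag_levy_seminorm.intro cadlag_levy.intro cadlag_levy_seminorm_axioms.intro)
    show "cadlag_markov_process \<nu> M F X \<theta> P" by (rule assms)
    show "prob_space (\<nu> t)" if "t > 0" for t
      using assms(6) that by (auto simp: levy_measures_def)
    show sets_nu: "sets (\<nu> t) = sets borel" if "t > 0" for t
      using assms(6) that by (auto simp: levy_measures_def)
    show "Q (y + w) \<le> 2 * Q y + 2 * Q w" for y w
      unfolding Q_def by (intro qsum_add a b A B)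
    show "Q (- w) = Q w" for w
      unfolding Q_def by (intro qsum_minus A B)
    show "compact {y. Q y \<le> ennreal c}" for c by (rule compact_level)
    show "C' \<ge> 0"
      using a b C(1) by (simp add: C'_def suminf_nonneg)
    show "(\<integral>\<^sup>+w. Q w \<partial>\<nu> t) \<le> ennreal (C' * (1 + t\<^sup>2))" if t: "t > 0" for t
    proof -
      have [measurable_cong]: "sets (\<nu> t) = sets borel" by (rule sets_nu[OF t])
      have [measurable]: "A n \<in> borel_measurable borel" "B n \<in> borel_measurable borel" for n
        using A B by (auto intro: borel_measurable_continuous_onI linear_continuous_on)
      have "(\<integral>\<^sup>+w. Q w \<partial>\<nu> t) \<le> ennreal ((suminf a + (suminf b)\<^sup>2) * (C * (1 + t\<^sup>2)))"
        unfolding Q_def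
        using C(1) C(2)[OF e t] C(2)[OF ex t]
        by (intro nn_integral_qsum_le a b) (auto simp: norm_basis A_def[symmetric] B_def[symmetric])
      then show ?thesis by (simp add: C'_def mult.assoc)
    qed
  qed
  have dom: "E_shift j e lam \<alpha> ex z = shifted_dom z" for z
  proof -
    have "q_fun j e lam \<alpha> ex y < \<infinity> \<longleftrightarrow> Q y < \<infinity>" for y
      unfolding q[symmetric] by (simp add: power_less_top_ennreal)
    then have "E_sub j e lam \<alpha> ex = {y. Q y < \<infinity>}" by (simp add: E_sub_def)
    moreover have "y \<in> (\<lambda>y. y + z) ` S \<longleftrightarrow> y - z \<in> S" for y S
      by (metis (no_types, lifting) add_diff_cancel diff_add_cancel image_iff)
    ultimately show ?thesis
      by (auto simp only: E_shift_def shifted_dom_def mem_Collect_eq set_eq_iff)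
  qed
  have v: "v_fun j \<nu> e lam \<alpha> ex z = lyapunov z" for z
  proof -
    have "inv (\<lambda>y. y + z) = (\<lambda>y. y - z)"
      by (rule inv_equality) auto
    then show ?thesis by (simp add: v_fun_def q lyapunov_def[abs_def] fun_eq_iff)
  qed
  show ?thesis
    unfolding dom v
    using compact_lyapunov lyapunov_finite shifted_dom_invariant paths_in_shifted_dom by auto
qed

end
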